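(* Let $D\subset\mathbb{C}$ be a direct tract of a function $f$, with boundary value $R>0$, and suppose that the boundary $\partial D$ is an unbounded simple curve. Then $D$ is a logarithmic tract of $f$; that is, the restriction $f:D\to\{z\in\mathbb{C}:|z|>R\}$ is a universal covering.
   Context: Let $D$ be an unbounded domain in $\mathbb{C}$ whose boundary consists of piecewise smooth curves and suppose that the complement of $D$ is unbounded. Let $f$ be a complex-valued function whose domain of definition contains the closure $\overline{D}$ of $D$. Then $D$ is called a direct tract of $f$ if $f$ is holomorphic in $D$, continuous in $\overline{D}$, and there exists $R>0$ such that $|f(z)|=R$ for $z\in\partial D$ while $|f(z)|>R$ for $z\in D$. The number $R$ is called the boundary value of the direct tract. If, in addition, the restriction $f:D\to\{z\in\mathbb{C}:|z|>R\}$ is a universal covering, then $D$ is called a logarithmic tract of $f$. An unbounded simple curve forming the boundary of $D$ is understood to be a simple curve in $\mathbb{C}$ both of whose ends tend to $\infty$, so that $\partial D\cup\{\infty\}$ is a Jordan curve in the Riemann sphere and $D$ is a Jordan domain in the Riemann sphere. *)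

theory Defs
  imports "HOL-Complex_Analysis.Complex_Analysis"
begin

definition smooth_arc_on :: "real \<Rightarrow> real \<Rightarrow> (real \<Rightarrow> complex) \<Rightarrow> bool" where
  "smooth_arc_on a b \<gamma> \<longleftrightarrow>
     (\<exists>\<gamma>'. continuous_on {a..b} \<gamma>' \<and>
       (\<forall>t\<in>{a..b}. \<gamma>' t \<noteq> 0 \<and> (\<gamma> has_vector_derivative \<gamma>' t) (at t within {a..b})))"

definition piecewise_smooth_on :: "real \<Rightarrow> real \<Rightarrow> (real \<Rightarrow> complex) \<Rightarrow> bool" where
  "piecewise_smooth_on a b \<gamma> \<longleftrightarrow>
     (\<exists>(n::nat) s. s 0 = a \<and> s n = b \<and>
       (\<forall>i<n. s i < s (Suc i) \<and> smooth_arc_on (s i) (s (Suc i)) \<gamma>))"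

text \<open>
  Boundary curves may be compact (for instance closed) or unbounded, so the parameter interval
  may be unbounded; corners are then only required to be finite in number on compact
  subintervals. Continuity follows from one-sided differentiability at the partition points.
\<close>

definition piecewise_smooth_curve :: "real set \<Rightarrow> (real \<Rightarrow> complex) \<Rightarrow> bool" where
  "piecewise_smooth_curve I \<gamma> \<longleftrightarrow>
     is_interval I \<and> closed I \<and> interior I \<noteq> {} \<and>
     (\<forall>a b. a < b \<and> {a..b} \<subseteq> I \<longrightarrow> piecewise_smooth_on a b \<gamma>)"

text \<open>
  The curves need be neither simple nor disjoint, since level curves of \<open>\<bar>f\<bar>\<close> can cross.
\<close>

definition consists_of_piecewise_smooth_curves :: "complex set \<Rightarrow> bool" where
  "consists_of_piecewise_smooth_curves B \<longleftrightarrow>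
     (\<exists>\<C>. (\<forall>(I, \<gamma>)\<in>\<C>. piecewise_smooth_curve I \<gamma>) \<and> B = (\<Union>(I, \<gamma>)\<in>\<C>. \<gamma> ` I))"

definition direct_tract :: "(complex \<Rightarrow> complex) \<Rightarrow> complex set \<Rightarrow> real \<Rightarrow> bool" where
  "direct_tract f D R \<longleftrightarrow>
     open D \<and> connected D \<and> \<not> bounded D \<and> \<not> bounded (- D) \<and>
     consists_of_piecewise_smooth_curves (frontier D) \<and>
     f holomorphic_on D \<and> continuous_on (closure D) f \<and>
     R > 0 \<and> (\<forall>z\<in>frontier D. norm (f z) = R) \<and> (\<forall>z\<in>D. norm (f z) > R)"

definition universal_covering ::
  "'a::real_normed_vector set \<Rightarrow> ('a \<Rightarrow> 'b::real_normed_vector) \<Rightarrow> 'b set \<Rightarrow> bool" where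
  "universal_covering X p S \<longleftrightarrow> covering_space X p S \<and> simply_connected X"

definition logarithmic_tract :: "(complex \<Rightarrow> complex) \<Rightarrow> complex set \<Rightarrow> real \<Rightarrow> bool" where
  "logarithmic_tract f D R \<longleftrightarrow>
     direct_tract f D R \<and> universal_covering D f {z. norm z > R}"

definition unbounded_simple_curve :: "complex set \<Rightarrow> bool" where
  "unbounded_simple_curve B \<longleftrightarrow>
     (\<exists>\<gamma> :: real \<Rightarrow> complex. continuous_on UNIV \<gamma> \<and> inj \<gamma> \<and>
       filterlim \<gamma> at_infinity at_top \<and> filterlim \<gamma> at_infinity at_bot \<and> B = range \<gamma>)"

end

theory Submission imports Defs begin

text \<open>
  The domain \<open>D\<close> is simply connected, because its boundary is connected and unbounded. As
  \<open>\<bar>f\<bar> > R > 0\<close> on \<open>D\<close>, there is a holomorphic \<open>g\<close> with \<open>f = R exp g\<close>; it maps \<open>D\<close> into the right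
  half-plane, and \<open>u = Re g\<close> tends to \<open>0\<close> at every finite boundary point. The whole content of the
  theorem is that \<open>g\<close> maps \<open>D\<close> biholomorphically onto the half-plane: then \<open>f\<close> is a restriction of the
  covering \<open>exp\<close>, composed with a homeomorphism. The classical argument transports \<open>u\<close> to a half-plane by
  a Riemann map that extends to the boundary. The proof below stays in \<open>D\<close> and derives bijectivity of
  \<open>g\<close> from the connectedness of \<open>\<partial>D\<close>, by way of the topology of the level sets of \<open>u\<close>.

  Extend \<open>u\<close> by \<open>0\<close> to the plane; this is continuous. The Phragmen--Lindelof principle
  (\<open>Phragmen_Lindelof\<close>) says that the boundary point \<open>\<infinity>\<close> is negligible for bounded below harmonic
  functions. So a component of \<open>{u < e}\<close> cannot lie in \<open>D\<close>, for there \<open>u\<close> would be at least \<open>e\<close>.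
  Every component thus meets the connected set \<open>\<partial>D\<close>, and \<open>{u < e}\<close> is connected
  (\<open>connected_sublevel\<close>).

  The set \<open>{u > e}\<close> is connected as well (\<open>connected_superlevel\<close>); this is the point at which it
  matters that \<open>D\<close> has just one access to \<open>\<infinity>\<close>. All its components are unbounded. If there
  were two of them, take slightly smaller unbounded pieces, one in each, on which \<open>u > e1 > e\<close>, and
  join these by a path in \<open>D\<close>. Add the path to \<open>{u \<ge> e1}\<close>, and fill in all complementary
  components except that of \<open>\<partial>D\<close>, to get a closed set \<open>X \<subseteq> D\<close> with connected complement. Far away
  \<open>u \<ge> e1\<close> on the boundary of \<open>X\<close>, and a barrier at \<open>\<infinity>\<close> shows \<open>u > e\<close> on \<open>X\<close> far away
  (\<open>far_superlevel\<close>). So near \<open>\<infinity>\<close> the set \<open>X\<close> splits into two ends, belonging to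
  different components of \<open>{u > e}\<close> but joined within \<open>X\<close>. The point at infinity closes this up to a
  loop in \<open>X \<union> {\<infinity>}\<close>, whereas a compact set with connected complement carries no
  essential map to the circle (\<open>connected_complement_one_end\<close>).

  By unicoherence of the plane, \<open>{u = e} = {u \<le> e} \<inter> {u \<ge> e}\<close> is connected
  (\<open>connected_level\<close>). If there are no critical points on it, it is a connected 1-manifold on which
  \<open>Im g\<close> is a local homeomorphism to the line, hence injective. Only countably many levels are
  critical, and by the open mapping theorem injectivity on the others gives injectivity of \<open>g\<close>
  (\<open>inj_on_g\<close>).

  Finally, if \<open>g\<close> omits a value \<open>c\<close> of the half-plane, a square root of the Cayley transform
  \<open>(g - c) / (g + cnj c)\<close> omits a whole ball. The reciprocal of a Blaschke factor with zero in that ball gives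
  a bounded holomorphic function on \<open>D\<close> with modulus greater than 1 inside and tending to 1 at the finite
  boundary, against the Phragmen--Lindelof principle (\<open>image_g\<close>).
\<close>

section \<open>A Phragmen--Lindelof principle\<close>

lemma eventually_at_within_in: "eventually (\<lambda>z. z \<in> S) (at x within S)"
  unfolding eventually_at_topological by blast

text \<open>
  If \<open>s\<close> is a square root of an injective zero-free function, the images of \<open>s\<close> and \<open>- s\<close> are
  disjoint. So \<open>s\<close> omits the reflection of any ball inside its image.
\<close>

lemma square_root_omits_ball:
  fixes D :: "complex set"
  assumes "open D" "D \<noteq> {}" "s holomorphic_on D"
    and inj: "\<And>x y. x \<in> D \<Longrightarrow> y \<in> D \<Longrightarrow> (s x)\<^sup>2 = (s y)\<^sup>2 \<Longrightarrow> x = y"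
    and s0: "\<And>z. z \<in> D \<Longrightarrow> s z \<noteq> 0"
  obtains d \<rho> where "d \<in> D" "\<rho> > 0" "\<And>z. z \<in> D \<Longrightarrow> \<rho> \<le> norm (s z + s d)"
proof -
  obtain d where d: "d \<in> D" using assms(2) by blast
  have "inj_on s D" by (rule inj_onI) (use inj in auto)
  then have "open (s ` D)" using open_mapping_thm3[OF assms(3,1)] by blast
  then obtain \<rho> where \<rho>: "\<rho> > 0" "ball (s d) \<rho> \<subseteq> s ` D"
    using d by (meson image_eqI openE)
  have "\<rho> \<le> norm (s z + s d)" if z: "z \<in> D" for z
  proof (rule ccontr)
    assume "\<not> ?thesis"
    then have "- s z \<in> ball (s d) \<rho>"
      by (simp add: dist_norm norm_minus_commute add.commute)
    then obtain y where y: "y \<in> D" "s y = - s z" using \<rho>(2) by force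
    then have "y = z" using inj z by simp
    then show False using y(2) s0[OF z] by simp
  qed
  then show thesis using that d \<rho>(1) by blast
qed

text \<open>
  This is the Phragmen--Lindelof barrier. A suitable \<open>\<beta>\<close> is a logarithm of a multiple of \<open>s + s d\<close>,
  where \<open>s\<close> is a branch of the square root of \<open>z - a\<close>. The constant \<open>s d\<close> keeps the modulus of the sum
  away from \<open>0\<close> even if \<open>a\<close> is a boundary point of \<open>D\<close>.
\<close>

lemma escape_function:
  fixes D :: "complex set"
  assumes "open D" "simply_connected D" "a \<notin> D"
  obtains \<beta> where "\<beta> holomorphic_on D" "\<And>z. z \<in> D \<Longrightarrow> 0 \<le> Re (\<beta> z)"
    "\<And>M. \<exists>r. \<forall>z\<in>D. r \<le> norm z \<longrightarrow> M \<le> Re (\<beta> z)"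
proof (cases "D = {}")
  case True
  then show ?thesis using that[of "\<lambda>_. 0"] by auto
next
  case False
  have "(\<lambda>z. z - a) holomorphic_on D" "\<forall>z\<in>D. z - a \<noteq> 0"
    using assms by (auto intro!: holomorphic_intros)
  then obtain s where s: "s holomorphic_on D" "\<And>z. z \<in> D \<Longrightarrow> z - a = (s z)\<^sup>2"
    using assms simply_connected_eq_holomorphic_sqrt[OF \<open>open D\<close>] by blast
  have s0: "s z \<noteq> 0" if "z \<in> D" for z
    using s(2)[OF that] that assms(3) by auto
  have "x = y" if "x \<in> D" "y \<in> D" "(s x)\<^sup>2 = (s y)\<^sup>2" for x y
    using that s(2) by (metis diff_add_cancel)
  then obtain d \<rho> where d: "d \<in> D" and \<rho>: "\<rho> > 0" and far: "\<And>z. z \<in> D \<Longrightarrow> \<rho> \<le> norm (s z + s d)"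
    using square_root_omits_ball[OF \<open>open D\<close> False s(1) _ s0] by blast
  have nz: "s z + s d \<noteq> 0" if "z \<in> D" for z
    using far[OF that] \<rho> by auto
  have "(\<lambda>z. (s z + s d) / \<rho>) holomorphic_on D" "\<forall>z\<in>D. (s z + s d) / \<rho> \<noteq> 0"
    using s(1) nz \<rho> by (auto intro!: holomorphic_intros)
  then obtain \<beta> where \<beta>: "\<beta> holomorphic_on D" "\<And>z. z \<in> D \<Longrightarrow> (s z + s d) / \<rho> = exp (\<beta> z)"
    using assms simply_connected_eq_holomorphic_log[OF \<open>open D\<close>] by blast
  have norm_exp: "exp (Re (\<beta> z)) = norm (s z + s d) / \<rho>" if "z \<in> D" for z
    using \<beta>(2)[OF that] \<rho> by (metis norm_divide norm_exp_eq_Re norm_of_real abs_of_pos)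
  show thesis
  proof
    show "\<beta> holomorphic_on D" by fact
    show "0 \<le> Re (\<beta> z)" if "z \<in> D" for z
    proof -
      have "1 \<le> exp (Re (\<beta> z))"
        unfolding norm_exp[OF that] using far[OF that] \<rho> by (simp add: le_divide_eq)
      then show ?thesis by simp
    qed
    show "\<exists>r. \<forall>z\<in>D. r \<le> norm z \<longrightarrow> M \<le> Re (\<beta> z)" for M
    proof (intro exI ballI impI)
      define N where "N = \<rho> * exp M + norm (s d)"
      fix z assume z: "z \<in> D" "N\<^sup>2 + norm a \<le> norm z"
      have "N\<^sup>2 \<le> norm (z - a)"
        using z norm_triangle_ineq2[of z a] by linarith
      also have "\<dots> = (norm (s z))\<^sup>2"
        using s(2)[OF z(1)] by (simp add: norm_power)
      finally have "N \<le> norm (s z)"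
        by (rule power2_le_imp_le) simp
      then have "\<rho> * exp M \<le> norm (s z + s d)"
        unfolding N_def using norm_diff_ineq[of "s z" "s d"] by linarith
      then have "exp M \<le> exp (Re (\<beta> z))"
        unfolding norm_exp[OF z(1)] using \<rho> by (simp add: le_divide_eq mult.commute)
      then show "M \<le> Re (\<beta> z)" by simp
    qed
  qed
qed

text \<open>
  The set where \<open>Re F \<le> m\<close> is compact, so if it is not empty then \<open>Re F\<close> has a minimum on \<open>W\<close>. By the
  maximum modulus principle for \<open>exp (- F)\<close>, the set of minimum points is open. It is also compact, which
  is impossible in the plane.
\<close>

lemma minimum_principle_finite:
  fixes W :: "complex set"
  assumes "open W" "F holomorphic_on W"
    and bdry: "\<And>\<zeta>. \<zeta> \<in> frontier W \<Longrightarrow> eventually (\<lambda>z. Re (F z) > m) (at \<zeta> within W)"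
    and infty: "\<And>z. z \<in> W \<Longrightarrow> r \<le> norm z \<Longrightarrow> m < Re (F z)"
    and z: "z \<in> W"
  shows "m < Re (F z)"
proof (rule ccontr)
  assume neg: "\<not> ?thesis"
  define E where "E = {z\<in>W. Re (F z) \<le> m}"
  have contF: "continuous_on W F"
    using assms(2) by (rule holomorphic_on_imp_continuous_on)
  have "closed E"
    unfolding closed_limpt
  proof (intro allI impI)
    fix x assume x: "x islimpt E"
    then have "x islimpt W"
      by (rule islimpt_subset) (auto simp: E_def)
    then have "x \<in> closure W" by (simp add: closure_def)
    have freq: "frequently (\<lambda>z. Re (F z) \<le> m) (at x within W)"
    proof (rule ccontr)
      assume "\<not> ?thesis"
      then have "eventually (\<lambda>z. \<not> Re (F z) \<le> m) (at x within W)"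
        by (simp add: frequently_def)
      then have "eventually (\<lambda>z. z \<notin> E) (at x)"
        unfolding eventually_at_filter by (rule eventually_mono) (auto simp: E_def)
      then show False using x by (simp add: islimpt_iff_eventually)
    qed
    have "x \<notin> frontier W"
      using bdry[of x] freq by (auto simp: frequently_def not_le)
    then have xW: "x \<in> W"
      using \<open>x \<in> closure W\<close> \<open>open W\<close> by (simp add: frontier_def interior_open)
    have "((\<lambda>z. Re (F z)) \<longlongrightarrow> Re (F x)) (at x within W)"
      using contF xW by (auto simp: continuous_on_def intro!: tendsto_Re)
    then have "\<not> m < Re (F x)"
      using freq order_tendstoD(1) by (force simp: frequently_def not_le)
    then show "x \<in> E" using xW by (simp add: E_def)
  qed
  moreover have "bounded E"
    unfolding bounded_iff E_def using infty by (metis (mono_tags, lifting) leD linorder_le_cases mem_Collect_eq)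
  ultimately have "compact E" by (simp add: compact_eq_bounded_closed)
  moreover have "E \<noteq> {}" using z neg by (auto simp: E_def)
  moreover have "continuous_on E (\<lambda>z. Re (F z))"
    by (intro continuous_on_Re continuous_on_subset[OF contF]) (auto simp: E_def)
  ultimately obtain p where p: "p \<in> E" "\<And>z. z \<in> E \<Longrightarrow> Re (F p) \<le> Re (F z)"
    by (meson continuous_attains_inf)
  have pmin: "Re (F p) \<le> Re (F z)" if "z \<in> W" for z
    using p that unfolding E_def by force
  define Q where "Q = {z\<in>E. Re (F z) = Re (F p)}"
  have "Q = E \<inter> (\<lambda>z. Re (F z)) -` {Re (F p)}" by (auto simp: Q_def)
  then have "closed Q"
    using \<open>closed E\<close> \<open>continuous_on E (\<lambda>z. Re (F z))\<close>
    by (simp add: continuous_closed_preimage)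
  moreover have "open Q"
    unfolding open_contains_ball
  proof
    fix q assume q: "q \<in> Q"
    then have "q \<in> W" by (auto simp: Q_def E_def)
    then obtain e where e: "e > 0" "ball q e \<subseteq> W" using \<open>open W\<close> openE by blast
    have "(\<lambda>z. exp (- F z)) constant_on ball q e"
    proof (rule maximum_modulus_principle[of _ _ "ball q e" q])
      show "(\<lambda>z. exp (- F z)) holomorphic_on ball q e"
        by (intro holomorphic_intros holomorphic_on_subset[OF assms(2) e(2)])
      show "norm (exp (- F z)) \<le> norm (exp (- F q))" if "z \<in> ball q e" for z
        using pmin[of z] e that q by (auto simp: norm_exp_eq_Re Q_def)
    qed (use e in auto)
    then have const: "exp (- F z) = exp (- F q)" if "z \<in> ball q e" for z
      using that e unfolding constant_on_def by (metis centre_in_ball)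
    have "z \<in> Q" if z: "z \<in> ball q e" for z
    proof -
      have "Re (F z) = Re (F q)"
        using arg_cong[OF const[OF z], of norm] by simp
      moreover have "z \<in> W" using e(2) z by (rule subsetD)
      ultimately show ?thesis using q by (simp add: Q_def E_def)
    qed
    then have "ball q e \<subseteq> Q" by (rule subsetI)
    then show "\<exists>e>0. ball q e \<subseteq> Q"
      using e(1) by blast
  qed
  moreover have "p \<in> Q" using p by (simp add: Q_def)
  ultimately have "Q = UNIV"
    using clopen by blast
  moreover have "bounded Q" using \<open>bounded E\<close> by (rule bounded_subset) (auto simp: Q_def)
  ultimately show False by simp
qed

text \<open>
  Apply the minimum principle to \<open>h + \<eta> \<beta>\<close>, with \<open>\<beta>\<close> the escape function of \<open>D\<close>, and let
  \<open>\<eta>\<close> tend to \<open>0\<close>. The lower bound \<open>- M\<close> may be arbitrarily bad: the real part of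
  \<open>\<eta> \<beta>\<close> beats it near infinity.
\<close>

lemma Phragmen_Lindelof:
  fixes D W :: "complex set"
  assumes "open D" "simply_connected D" "D \<noteq> UNIV"
    and "open W" "W \<subseteq> D" "h holomorphic_on W"
    and lower: "\<And>z. z \<in> W \<Longrightarrow> - M \<le> Re (h z)"
    and bdry: "\<And>\<zeta> e. \<zeta> \<in> frontier W \<Longrightarrow> e > 0 \<Longrightarrow> eventually (\<lambda>z. Re (h z) > - e) (at \<zeta> within W)"
    and z: "z \<in> W"
  shows "0 \<le> Re (h z)"
proof -
  obtain a where "a \<notin> D" using assms(3) by blast
  then obtain \<beta> where \<beta>: "\<beta> holomorphic_on D" "\<And>z. z \<in> D \<Longrightarrow> 0 \<le> Re (\<beta> z)"
    "\<And>M. \<exists>r. \<forall>z\<in>D. r \<le> norm z \<longrightarrow> M \<le> Re (\<beta> z)"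
    using escape_function[OF assms(1,2)] by metis
  have main: "- e < Re (h z) + \<eta> * Re (\<beta> z)" if e: "e > 0" and \<eta>: "\<eta> > 0" for e \<eta>
  proof -
    obtain r where r: "\<And>z. z \<in> D \<Longrightarrow> r \<le> norm z \<Longrightarrow> M / \<eta> \<le> Re (\<beta> z)"
      using \<beta>(3) by metis
    have "- e < Re (h z + \<eta> * \<beta> z)"
    proof (rule minimum_principle_finite[OF \<open>open W\<close> _ _ _ z])
      show "(\<lambda>z. h z + \<eta> * \<beta> z) holomorphic_on W"
        using assms(6) holomorphic_on_subset[OF \<beta>(1) assms(5)] by (intro holomorphic_intros)
      show "eventually (\<lambda>z. - e < Re (h z + \<eta> * \<beta> z)) (at \<zeta> within W)"
        if "\<zeta> \<in> frontier W" for \<zeta>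
        using bdry[OF that e] eventually_at_within_in[of W \<zeta>]
      proof eventually_elim
        case (elim z)
        then have "0 \<le> \<eta> * Re (\<beta> z)" using \<beta>(2)[of z] assms(5) \<eta> by auto
        with elim show ?case by simp
      qed
      show "- e < Re (h z + \<eta> * \<beta> z)" if "z \<in> W" "r \<le> norm z" for z
      proof -
        have "M \<le> \<eta> * Re (\<beta> z)"
          using r[of z] that assms(5) \<eta> by (auto simp: field_simps)
        then show ?thesis using lower[OF that(1)] e by simp
      qed
    qed
    then show ?thesis by simp
  qed
  show ?thesis
  proof (rule ccontr)
    assume "\<not> ?thesis"
    then have neg: "Re (h z) < 0" by simp
    define e where "e = - Re (h z) / 2"
    define \<eta> where "\<eta> = e / (Re (\<beta> z) + 1)"
    have b0: "0 \<le> Re (\<beta> z)" using \<beta>(2) z assms(5) by blast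
    have "e > 0" "\<eta> > 0" using neg b0 by (simp_all add: e_def \<eta>_def divide_neg_pos)
    moreover have "\<eta> * Re (\<beta> z) \<le> e"
      using b0 \<open>e > 0\<close> by (simp add: \<eta>_def field_simps)
    ultimately show False using main[of e \<eta>] by (simp add: e_def)
  qed
qed

section \<open>A closed plane set with connected complement has one end\<close>

lemma inversion_compactifies:
  fixes X :: "complex set"
  assumes "closed X" "connected (- X)" "v \<notin> X"
  defines "Y \<equiv> insert 0 ((\<lambda>z. inverse (z - v)) ` X)"
  shows "compact Y" "connected (- Y)"
proof -
  let ?j = "\<lambda>z. inverse (z - v)"
  have eq: "- Y = ?j ` (- X - {v})"
  proof (intro equalityI subsetI)
    fix w assume w: "w \<in> - Y"
    then have "w \<noteq> 0" and "w \<notin> ?j ` X" by (auto simp: Y_def)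
    moreover have w': "w = ?j (v + inverse w)" by simp
    ultimately have "v + inverse w \<in> - X - {v}" by (auto simp: image_iff)
    with w' show "w \<in> ?j ` (- X - {v})" by (rule image_eqI)
  next
    fix w assume "w \<in> ?j ` (- X - {v})"
    then show "w \<in> - Y"
      by (auto simp: Y_def)
  qed
  have inj: "inj_on ?j (- X - {v})"
    by (auto simp: inj_on_def)
  have op: "open (- X - {v})" using assms(1) by (simp add: open_delete open_Compl)
  have hol: "?j holomorphic_on (- X - {v})"
    by (intro holomorphic_intros) auto
  have "open (- Y)"
    unfolding eq by (rule open_mapping_thm3[OF hol op inj])
  then have "closed Y" by (simp add: closed_def)
  obtain \<rho> where \<rho>: "\<rho> > 0" "ball v \<rho> \<subseteq> - X"
    using assms(1,3) by (metis Compl_iff open_Compl openE)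
  have "norm w \<le> inverse \<rho>" if w: "w \<in> Y" for w
  proof (cases "w = 0")
    case False
    then obtain z where z: "z \<in> X" "w = ?j z" using w by (auto simp: Y_def)
    then have "\<rho> \<le> norm (z - v)"
      using \<rho> by (metis Compl_iff dist_norm linorder_not_le mem_ball norm_minus_commute subset_iff)
    then show ?thesis using \<rho> z by (simp add: norm_inverse le_imp_inverse_le)
  qed (use \<rho> in auto)
  then have "bounded Y" by (auto simp: bounded_iff)
  with \<open>closed Y\<close> show "compact Y" by (simp add: compact_eq_bounded_closed)
  have "connected (- X - {v})"
    using assms by (intro connected_open_delete) auto
  then show "connected (- Y)"
    unfolding eq by (intro connected_continuous_image holomorphic_on_imp_continuous_on[OF hol])
qed

lemma unbounded_sequence:
  fixes S :: "complex set"
  assumes "\<not> bounded S"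
  shows "\<exists>x. \<forall>n. x n \<in> S \<and> norm (x n) \<ge> real n"
proof -
  have "\<exists>z\<in>S. norm z \<ge> real n" for n
    using assms unfolding bounded_iff by (meson linorder_le_cases)
  then show ?thesis by metis
qed

text \<open>
  A real function \<open>t\<close> on \<open>X\<close> that tends to \<open>+\<infinity>\<close> in \<open>Y1\<close> and to \<open>-\<infinity>\<close> in \<open>Y2\<close>
  makes \<open>exp (2 \<i> arctan t)\<close> a continuous map from \<open>X \<union> {\<infinity>}\<close> to the circle, with the
  value \<open>-1\<close> at \<open>\<infinity>\<close>. Inversion turns \<open>X \<union> {\<infinity>}\<close> into a compact plane set with
  connected complement, on which such a map has a continuous logarithm \<open>\<theta>\<close> (Borsuk). On the connected
  set \<open>K\<close>, \<open>\<theta>\<close> and \<open>2 \<i> arctan t\<close> differ by a constant. Going to \<open>\<infinity>\<close> within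
  \<open>K \<inter> Y1\<close> and within \<open>K \<inter> Y2\<close> then yields two values of \<open>\<theta>\<close> at \<open>\<infinity>\<close> that
  differ by \<open>2 \<pi> \<i>\<close>.
\<close>

lemma connected_complement_one_end:
  fixes X K Y1 Y2 :: "complex set"
  assumes X: "closed X" "connected (- X)" "X \<noteq> UNIV"
    and Y: "closed Y1" "closed Y2" "Y1 \<inter> Y2 = {}" "X - ball 0 r \<subseteq> Y1 \<union> Y2"
    and K: "connected K" "K \<subseteq> X"
    and unbdd: "\<not> bounded (K \<inter> Y1)" "\<not> bounded (K \<inter> Y2)"
  shows False
proof -
  define m where "m = (\<lambda>z::complex. max 0 (norm z - r))"
  define t where "t = (\<lambda>z. if z \<in> Y1 then m z else - m z)"
  have contm: "continuous_on A m" for A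
    unfolding m_def by (intro continuous_intros)
  have contt: "continuous_on X t"
  proof -
    have 1: "continuous_on ((X \<inter> Y1) \<union> (X \<inter> Y2 \<union> X \<inter> cball 0 r)) t"
      unfolding t_def
    proof (rule continuous_on_cases)
      show "\<forall>x. (x \<in> X \<inter> Y1 \<and> x \<notin> Y1) \<or> (x \<in> X \<inter> Y2 \<union> X \<inter> cball 0 r \<and> x \<in> Y1) \<longrightarrow> m x = - m x"
        using Y by (auto simp: m_def)
    qed (use X Y contm in \<open>auto intro!: continuous_intros closed_Un closed_Int\<close>)
    have "X \<subseteq> (X \<inter> Y1) \<union> (X \<inter> Y2 \<union> X \<inter> cball 0 r)" using Y(4) by auto
    with 1 show ?thesis by (rule continuous_on_subset)
  qed
  have tabs: "\<bar>t z\<bar> \<ge> norm z - r" for z by (auto simp: t_def m_def)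
  obtain v where v: "v \<notin> X" using X by blast
  define j where "j = (\<lambda>z. inverse (z - v))"
  define Z where "Z = insert 0 (j ` X)"
  have Z: "compact Z" "connected (- Z)"
    using inversion_compactifies[OF X(1,2) v] by (simp_all add: Z_def j_def)
  \<comment> \<open>The circle-valued map, in the coordinate \<open>w = j z\<close>; the point \<open>w = 0\<close> stands for \<open>\<infinity>\<close>.\<close>
  define F where "F = (\<lambda>w. if w = 0 then -1 else exp (2 * \<i> * of_real (arctan (t (v + inverse w)))))"
  have jinv: "v + inverse (j z) = z" for z by (simp add: j_def)
  have j0: "j z \<noteq> 0" if "z \<in> X" for z using that v by (auto simp: j_def)
  have Fj: "F (j z) = exp (2 * \<i> * of_real (arctan (t z)))" if "z \<in> X" for z
    using j0[OF that] by (simp add: F_def jinv)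
  \<comment> \<open>The angle \<open>2 arctan t\<close> tends to \<open>\<pi>\<close> or \<open>-\<pi>\<close> according to the end, but the modulus of
    \<open>t\<close> alone decides the limits of its cosine and of its sine up to sign.\<close>
  have limF: "(F \<longlongrightarrow> -1) (at 0 within Z)"
  proof -
    have "filterlim (\<lambda>w::complex. v + inverse w) at_infinity (at 0 within Z)"
      by (intro tendsto_add_filterlim_at_infinity[OF tendsto_const] filterlim_mono[OF filterlim_inverse_at_infinity]) (auto simp: at_le)
    then have inf: "filterlim (\<lambda>w. norm (v + inverse w)) at_top (at 0 within Z)"
      using filterlim_compose[OF filterlim_norm_at_top] by blast
    have "filterlim (\<lambda>w. \<bar>t (v + inverse w)\<bar>) at_top (at 0 within Z)"
    proof (rule filterlim_at_top_mono)
      show "filterlim (\<lambda>w. -r + norm (v + inverse w)) at_top (at 0 within Z)"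
        using inf by (intro filterlim_tendsto_add_at_top[OF tendsto_const])
    qed (use tabs in \<open>auto simp: algebra_simps\<close>)
    then have "((\<lambda>w. arctan \<bar>t (v + inverse w)\<bar>) \<longlongrightarrow> pi/2) (at 0 within Z)"
      by (rule filterlim_compose[OF tendsto_arctan_at_top])
    then have A: "((\<lambda>w. cos (2 * arctan \<bar>t (v + inverse w)\<bar>)) \<longlongrightarrow> cos (2 * (pi/2))) (at 0 within Z)"
         and B: "((\<lambda>w. sin (2 * arctan \<bar>t (v + inverse w)\<bar>)) \<longlongrightarrow> sin (2 * (pi/2))) (at 0 within Z)"
      by (intro tendsto_intros; assumption)+
    have "((\<lambda>w. \<bar>sin (2 * arctan (t (v + inverse w)))\<bar>) \<longlongrightarrow> 0) (at 0 within Z)"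
    proof -
      have "((\<lambda>w. \<bar>sin (2 * arctan \<bar>t (v + inverse w)\<bar>)\<bar>) \<longlongrightarrow> \<bar>sin (2 * (pi/2))\<bar>) (at 0 within Z)"
        using B by (rule tendsto_rabs)
      moreover have "\<bar>sin (2 * arctan \<bar>x\<bar>)\<bar> = \<bar>sin (2 * arctan x)\<bar>" for x
        by (auto simp: abs_if arctan_minus)
      ultimately show ?thesis by simp
    qed
    then have B': "((\<lambda>w. sin (2 * arctan (t (v + inverse w)))) \<longlongrightarrow> 0) (at 0 within Z)"
      by (simp add: tendsto_rabs_zero_iff)
    have "cos (2 * arctan \<bar>x\<bar>) = cos (2 * arctan x)" for x
      by (auto simp: abs_if arctan_minus)
    with A have A': "((\<lambda>w. cos (2 * arctan (t (v + inverse w)))) \<longlongrightarrow> -1) (at 0 within Z)"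
      by simp
    have "((\<lambda>w. Complex (cos (2 * arctan (t (v + inverse w)))) (sin (2 * arctan (t (v + inverse w))))) \<longlongrightarrow> Complex (-1) 0) (at 0 within Z)"
      by (rule tendsto_Complex[OF A' B'])
    then have "((\<lambda>w. exp (2 * \<i> * of_real (arctan (t (v + inverse w))))) \<longlongrightarrow> -1) (at 0 within Z)"
    proof -
      have "exp (2 * \<i> * of_real x) = Complex (cos (2*x)) (sin (2*x))" for x
        by (simp add: complex_eq_iff Re_exp Im_exp)
      moreover have "Complex (-1) 0 = -1" by (simp add: complex_eq_iff)
      ultimately show ?thesis
        using \<open>((\<lambda>w. Complex _ _) \<longlongrightarrow> Complex (-1) 0) (at 0 within Z)\<close> by simp
    qed
    then show ?thesis
      by (rule Lim_transform_eventually) (auto simp: eventually_at_topological F_def)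
  qed
  have "continuous_on Z F"
    unfolding continuous_on_def
  proof
    fix w assume w: "w \<in> Z"
    show "(F \<longlongrightarrow> F w) (at w within Z)"
    proof (cases "w = 0")
      case True
      then show ?thesis using limF by (simp add: F_def)
    next
      case False
      have "continuous_on (Z - {0}) F"
      proof (rule continuous_on_eq)
        have "continuous_on (Z - {0}) (\<lambda>w. t (v + inverse w))"
          by (rule continuous_on_compose2[OF contt]) (auto intro!: continuous_intros simp: Z_def jinv)
        then show "continuous_on (Z - {0}) (\<lambda>w. exp (2 * \<i> * of_real (arctan (t (v + inverse w)))))"
          by (intro continuous_intros)
      qed (auto simp: F_def)
      then have "(F \<longlongrightarrow> F w) (at w within (Z - {0}))"
        using w False by (auto simp: continuous_on_def)
      moreover have "at w within (Z - {0}) = at w within Z"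
        by (rule at_within_nhd[of _ "- {0}"]) (use False in auto)
      ultimately show ?thesis by simp
    qed
  qed
  moreover have "F \<in> Z \<rightarrow> sphere 0 1"
    by (auto simp: F_def)
  ultimately obtain \<theta> where \<theta>: "continuous_on Z \<theta>" "\<And>w. w \<in> Z \<Longrightarrow> F w = exp (\<theta> w)"
    using Borsukian_separation_compact[OF Z(1)] Z(2) unfolding Borsukian_continuous_logarithm_circle
    by blast
  define d where "d = (\<lambda>z. \<theta> (j z) - 2 * \<i> * of_real (arctan (t z)))"
  have jZ: "j z \<in> Z" if "z \<in> X" for z using that by (auto simp: Z_def)
  have contj: "continuous_on X j"
    unfolding j_def using v by (intro continuous_intros) auto
  have dint: "\<exists>n::int. d z = of_real (2 * n * pi) * \<i>" if "z \<in> X" for z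
  proof -
    have "exp (d z) = 1"
      using Fj[OF that] \<theta>(2)[OF jZ[OF that]] by (simp add: d_def exp_diff)
    then obtain n :: int where "Re (d z) = 0" "Im (d z) = of_int (2 * n) * pi"
      unfolding exp_eq_1 by blast
    then have "d z = of_real (2 * n * pi) * \<i>" by (simp add: complex_eq_iff)
    then show ?thesis by auto
  qed
  have contd: "continuous_on X d"
    unfolding d_def
    by (intro continuous_intros continuous_on_compose2[OF \<theta>(1) contj] contt) (use jZ in auto)
  have "d constant_on K"
  proof (rule continuous_discrete_range_constant[OF K(1)])
    show "continuous_on K d" using contd K(2) by (rule continuous_on_subset)
    fix x assume "x \<in> K"
    then obtain n where n: "d x = of_real (2 * real_of_int n * pi) * \<i>" using dint K by blast
    show "\<exists>e>0. \<forall>y. y \<in> K \<and> d y \<noteq> d x \<longrightarrow> e \<le> norm (d y - d x)"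
    proof (intro exI conjI allI impI)
      show "(0::real) < 1" by simp
      fix y assume y: "y \<in> K \<and> d y \<noteq> d x"
      then obtain k where k: "d y = of_real (2 * real_of_int k * pi) * \<i>" using dint K by blast
      have "Im (d y - d x) = 2 * real_of_int (k - n) * pi"
        unfolding n k by (simp add: algebra_simps)
      moreover have "\<bar>2 * real_of_int (k - n) * pi\<bar> = 2 * real_of_int \<bar>k - n\<bar> * pi"
        unfolding abs_mult by simp
      ultimately have "2 * real_of_int \<bar>k - n\<bar> * pi \<le> norm (d y - d x)"
        using abs_Im_le_cmod[of "d y - d x"] by metis
      moreover have "k \<noteq> n" using y n k by auto
      then have "1 \<le> real_of_int \<bar>k - n\<bar>" by linarith
      then have "2 * 1 * 1 \<le> 2 * real_of_int \<bar>k - n\<bar> * pi"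
        using pi_ge_two by (intro mult_mono) auto
      ultimately show "1 \<le> norm (d y - d x)" by linarith
    qed
  qed
  then obtain c where c: "\<And>z. z \<in> K \<Longrightarrow> d z = c" by (auto simp: constant_on_def)
  have limit: "\<theta> 0 = c + 2 * \<i> * of_real L"
    if x: "\<And>n. x n \<in> K" "\<And>n. norm (x n) \<ge> real n" and L: "(\<lambda>n. arctan (t (x n))) \<longlonglongrightarrow> L" for x L
  proof -
    have "filterlim (\<lambda>n. norm (x n)) at_top sequentially"
      using filterlim_at_top_mono[OF filterlim_real_sequentially] x(2) by (simp add: eventuallyI)
    then have "filterlim x at_infinity sequentially"
      by (rule filterlim_norm_at_top_imp_at_infinity)
    then have "filterlim (\<lambda>n. -v + x n) at_infinity sequentially"
      by (rule tendsto_add_filterlim_at_infinity[OF tendsto_const])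
    then have "(\<lambda>n. inverse (-v + x n)) \<longlonglongrightarrow> 0"
      by (rule filterlim_compose[OF tendsto_inverse_0])
    then have "(\<lambda>n. j (x n)) \<longlonglongrightarrow> 0" by (simp add: j_def)
    then have A: "(\<lambda>n. \<theta> (j (x n))) \<longlonglongrightarrow> \<theta> 0"
    proof (rule continuous_on_tendsto_compose[OF \<theta>(1)])
      show "0 \<in> Z" by (simp add: Z_def)
      show "eventually (\<lambda>n. j (x n) \<in> Z) sequentially"
        using x(1) K(2) jZ by (intro always_eventually) blast
    qed
    have "\<theta> (j (x n)) = c + 2 * \<i> * of_real (arctan (t (x n)))" for n
      using c[OF x(1)[of n]] by (simp add: d_def algebra_simps)
    then have "(\<lambda>n. \<theta> (j (x n))) \<longlonglongrightarrow> c + 2 * \<i> * of_real L"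
      using L by (auto intro!: tendsto_intros)
    with A show ?thesis by (rule LIMSEQ_unique)
  qed
  have top: "filterlim (\<lambda>n. m (x n)) at_top sequentially" if "\<And>n. norm (x n) \<ge> real n" for x
  proof (rule filterlim_at_top_mono)
    show "filterlim (\<lambda>n. -r + real n) at_top sequentially"
      by (rule filterlim_tendsto_add_at_top[OF tendsto_const filterlim_real_sequentially])
    show "eventually (\<lambda>n. -r + real n \<le> m (x n)) sequentially"
      using that by (intro always_eventually) (smt (verit, best) m_def)
  qed
  obtain x where x: "\<And>n. x n \<in> K \<inter> Y1" "\<And>n. norm (x n) \<ge> real n"
    using unbounded_sequence[OF unbdd(1)] by blast
  have tx: "t (x n) = m (x n)" for n using x(1)[of n] by (simp add: t_def)
  have "(\<lambda>n. arctan (t (x n))) \<longlonglongrightarrow> pi/2"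
    unfolding tx by (rule filterlim_compose[OF tendsto_arctan_at_top top[OF x(2)]])
  then have 1: "\<theta> 0 = c + 2 * \<i> * of_real (pi/2)"
    using x by (intro limit) auto
  obtain y where y: "\<And>n. y n \<in> K \<inter> Y2" "\<And>n. norm (y n) \<ge> real n"
    using unbounded_sequence[OF unbdd(2)] by blast
  have ty: "t (y n) = - m (y n)" for n using y(1)[of n] Y(3) by (auto simp: t_def)
  have "(\<lambda>n. arctan (m (y n))) \<longlonglongrightarrow> pi/2"
    by (rule filterlim_compose[OF tendsto_arctan_at_top top[OF y(2)]])
  then have "(\<lambda>n. - arctan (m (y n))) \<longlonglongrightarrow> - (pi/2)" by (rule tendsto_minus)
  then have "(\<lambda>n. arctan (t (y n))) \<longlonglongrightarrow> - (pi/2)"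
    unfolding ty by (simp add: arctan_minus)
  then have 2: "\<theta> 0 = c + 2 * \<i> * of_real (- (pi/2))"
    using y by (intro limit) auto
  from 1 2 have "(2 * \<i> * of_real (pi/2) :: complex) = 2 * \<i> * of_real (- (pi/2))"
    by (metis add_left_cancel)
  then show False by (simp add: complex_eq_iff)
qed

lemma frontier_component_open:
  fixes P :: "complex set"
  assumes "open P"
  shows "frontier (connected_component_set P a) \<inter> P = {}"
proof -
  let ?W = "connected_component_set P a"
  have "x \<notin> P" if x: "x \<in> frontier ?W" for x
  proof
    assume xP: "x \<in> P"
    define C where "C = connected_component_set P x"
    have "open C" "x \<in> C" using assms xP by (auto simp: C_def open_connected_component)
    moreover have "x \<in> closure ?W" using x by (simp add: frontier_def)
    ultimately have "C \<inter> ?W \<noteq> {}" using open_Int_closure_eq_empty by blast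
    then have "C = ?W" unfolding C_def using connected_component_nonoverlap by blast
    then have "x \<in> ?W" using \<open>x \<in> C\<close> by simp
    then show False
      using x assms by (simp add: frontier_def interior_open open_connected_component)
  qed
  then show ?thesis by blast
qed

section \<open>Maps to the half-plane with vanishing boundary values\<close>

text \<open>
  The situation after taking the logarithm of \<open>f / R\<close>. The boundary condition concerns the finite boundary
  points; at \<open>\<infinity>\<close>, where \<open>g\<close> is expected to have its pole, nothing is prescribed.
\<close>

locale half_plane_map =
  fixes D :: "complex set" and g :: "complex \<Rightarrow> complex"
  assumes open_D: "open D" and simply_connected_D: "simply_connected D"
    and D_nonempty: "D \<noteq> {}" and D_not_UNIV: "D \<noteq> UNIV"
    and connected_frontier: "connected (frontier D)"
    and holomorphic_g: "g holomorphic_on D"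
    and Re_g_pos: "\<And>z. z \<in> D \<Longrightarrow> 0 < Re (g z)"
    and Re_g_boundary: "\<And>\<zeta>. \<zeta> \<in> frontier D \<Longrightarrow> ((\<lambda>z. Re (g z)) \<longlongrightarrow> 0) (at \<zeta> within D)"
begin

text \<open>
  The extension by \<open>0\<close> is what makes level sets accessible to the topology of the whole plane.
\<close>

definition u :: "complex \<Rightarrow> real" where
  "u z = (if z \<in> D then Re (g z) else 0)"

lemma connected_D: "connected D"
  using simply_connected_D by (rule simply_connected_imp_connected)

lemma frontier_nonempty: "frontier D \<noteq> {}"
  using D_nonempty D_not_UNIV frontier_eq_empty by blast

lemma frontier_disjoint: "frontier D \<inter> D = {}"
  using open_D by (simp add: frontier_disjoint_eq)

lemma continuous_g: "continuous_on D g"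
  using holomorphic_g by (rule holomorphic_on_imp_continuous_on)

lemma u_D: "z \<in> D \<Longrightarrow> u z = Re (g z)"
  by (simp add: u_def)

lemma continuous_u: "continuous_on A u"
proof -
  have "isCont u \<zeta>" for \<zeta>
  proof -
    consider "\<zeta> \<in> D" | "\<zeta> \<in> frontier D" | "\<zeta> \<in> - closure D"
      using open_D by (auto simp: frontier_def interior_open)
    then show ?thesis
    proof cases
      case 1
      then have "isCont (\<lambda>z. Re (g z)) \<zeta>"
        using continuous_g open_D by (auto simp: continuous_on_eq_continuous_at intro!: continuous_intros)
      then show ?thesis
        using 1 open_D
        by (subst isCont_cong[of u "\<lambda>z. Re (g z)"]) (auto simp: eventually_nhds u_D)
    next
      case 2
      then have "u \<zeta> = 0" using frontier_disjoint by (auto simp: u_def)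
      have "((\<lambda>z. u z) \<longlongrightarrow> 0) (at \<zeta> within D)"
        using Re_g_boundary[OF 2] by (rule Lim_transform_eventually)
          (simp add: eventually_at_topological u_D exI[of _ UNIV])
      moreover have "((\<lambda>z. u z) \<longlongrightarrow> 0) (at \<zeta> within -D)"
        by (rule Lim_transform_eventually[OF tendsto_const])
          (simp add: eventually_at_topological u_def exI[of _ UNIV])
      ultimately have "(u \<longlongrightarrow> 0) (at \<zeta> within (D \<union> -D))"
        by (rule Lim_Un)
      then show ?thesis using \<open>u \<zeta> = 0\<close> by (simp add: isCont_def)
    next
      case 3
      have "isCont (\<lambda>_. 0::real) \<zeta>" by simp
      moreover have "eventually (\<lambda>z. u z = 0) (nhds \<zeta>)"
        unfolding eventually_nhds using 3 closure_subset[of D]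
        by (intro exI[of _ "- closure D"]) (auto simp: u_def)
      ultimately show ?thesis
        using isCont_cong[of u "\<lambda>_. 0" \<zeta>] by simp
    qed
  qed
  then show ?thesis by (simp add: continuous_at_imp_continuous_on)
qed

lemma open_superlevel: "open {z. e < u z}"
  and closed_superlevel: "closed {z. e \<le> u z}" and closed_sublevel: "closed {z. u z \<le> e}"
  by (intro open_Collect_less closed_Collect_le continuous_u continuous_intros)+

lemma superlevel_subset: "0 < e \<Longrightarrow> {z. e \<le> u z} \<subseteq> D"
  by (auto simp: u_def split: if_splits)

lemma g_not_constant:
  assumes "open S" "S \<subseteq> D" "S \<noteq> {}"
  shows "\<not> g constant_on S"
proof
  assume "g constant_on S"
  then obtain c where c: "\<And>z. z \<in> S \<Longrightarrow> g z = c" by (auto simp: constant_on_def)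
  have gc: "g z = c" if "z \<in> D" for z
    by (rule analytic_continuation_open[of S D g "\<lambda>_. c" z])
      (use assms that c open_D connected_D holomorphic_g in auto)
  obtain \<zeta> where \<zeta>: "\<zeta> \<in> frontier D" using frontier_nonempty by blast
  have "((\<lambda>z. Re (g z)) \<longlongrightarrow> Re c) (at \<zeta> within D)"
    by (rule Lim_transform_eventually[OF tendsto_const])
      (simp add: eventually_at_topological gc exI[of _ UNIV])
  moreover have "at \<zeta> within D \<noteq> bot"
    using \<zeta> frontier_disjoint by (auto simp: trivial_limit_within frontier_def closure_def)
  ultimately have "Re c = 0"
    using Re_g_boundary[OF \<zeta>] tendsto_unique by blast
  moreover have "0 < Re c" using D_nonempty gc Re_g_pos by force
  ultimately show False by simp
qed

lemma open_image_g: "open S \<Longrightarrow> S \<subseteq> D \<Longrightarrow> open (g ` S)"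
  using open_mapping_thm2[OF holomorphic_g open_D] g_not_constant by blast

section \<open>Sublevel and superlevel sets are connected\<close>

lemma Phragmen_Lindelof_D:
  assumes "open W" "closure W \<subseteq> U" "open U" "U \<subseteq> D" "h holomorphic_on U"
    and "\<And>z. z \<in> W \<Longrightarrow> - M \<le> Re (h z)"
    and "\<And>z. z \<in> frontier W \<Longrightarrow> 0 \<le> Re (h z)"
    and "z \<in> W"
  shows "0 \<le> Re (h z)"
proof (rule Phragmen_Lindelof[OF open_D simply_connected_D D_not_UNIV \<open>open W\<close> _ _ _ _ \<open>z \<in> W\<close>])
  have "W \<subseteq> U" using assms(2) closure_subset by blast
  then show "W \<subseteq> D" "h holomorphic_on W"
    using assms(4) holomorphic_on_subset[OF assms(5)] by auto
  show "eventually (\<lambda>z. - e < Re (h z)) (at \<zeta> within W)" if \<zeta>: "\<zeta> \<in> frontier W" and e: "0 < e" for \<zeta> and e :: real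
  proof -
    have "\<zeta> \<in> U" using \<zeta> assms(2) by (auto simp: frontier_def)
    then have "isCont h \<zeta>"
      using holomorphic_on_imp_continuous_on[OF assms(5)] continuous_on_eq_continuous_at[OF assms(3)] by blast
    then have "((\<lambda>z. Re (h z)) \<longlongrightarrow> Re (h \<zeta>)) (at \<zeta> within W)"
      unfolding isCont_def by (intro tendsto_Re) (rule tendsto_within_subset, auto)
    moreover have "- e < Re (h \<zeta>)" using assms(7)[OF \<zeta>] e by simp
    ultimately show ?thesis by (rule order_tendstoD(1))
  qed
qed (use assms(6) in auto)

text \<open>
  Such a component cannot lie outside \<open>D\<close>: its own frontier is contained in \<open>K \<subseteq> D\<close>, so it would be
  clopen in the plane. As it is connected and avoids the frontier of \<open>D\<close>, it lies inside.
\<close>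

lemma component_avoiding_frontier:
  assumes "closed K" "K \<subseteq> D" "z \<notin> K" 
    and W: "W = connected_component_set (- K) z" "W \<inter> frontier D = {}"
  shows "closure W \<subseteq> D" "frontier W \<subseteq> K"
proof -
  have op: "open W" unfolding W using assms(1) by (simp add: open_connected_component open_Compl)
  have conn: "connected W" unfolding W by simp
  have zW: "z \<in> W" using assms(3) by (simp add: W)
  show fr: "frontier W \<subseteq> K"
    using frontier_component_open[of "- K" z] assms(1) W(1) by (auto simp: open_Compl)
  have "W \<inter> D \<noteq> {}"
  proof
    assume "W \<inter> D = {}"
    then have "closure W \<inter> D = {}" using open_D open_Int_closure_eq_empty by blast
    then have "frontier W = {}" using fr assms(2) by (auto simp: frontier_def)
    then have "W = UNIV" using zW frontier_eq_empty by blast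
    then show False using W(2) frontier_nonempty by simp
  qed
  then have "W \<subseteq> D"
    using connected_Int_frontier[OF conn, of D] W(2) by blast
  then show "closure W \<subseteq> D"
    using fr assms(2) op by (auto simp: frontier_def interior_open)
qed

text \<open>
  A component of \<open>{u < e}\<close> that avoids the frontier of \<open>D\<close> lies in \<open>D\<close> and has \<open>u \<ge> e\<close> on its
  frontier, so \<open>u \<ge> e\<close> on it by Phragmen--Lindelof, which is absurd. All components therefore contain
  the connected set \<open>frontier D\<close>, and there is only one.
\<close>

lemma connected_sublevel:
  assumes "0 < e"
  shows "connected {z. u z < e}"
proof -
  define K where "K = {z. e \<le> u z}"
  have K: "closed K" "K \<subseteq> D" and mK: "- K = {z. u z < e}"
    using closed_superlevel superlevel_subset[OF assms] by (auto simp: K_def)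
  obtain \<zeta> where \<zeta>: "\<zeta> \<in> frontier D" using frontier_nonempty by blast
  have sub: "frontier D \<subseteq> - K" using frontier_disjoint K(2) by blast
  have "frontier D \<subseteq> connected_component_set (- K) \<zeta>"
    by (rule connected_component_maximal[OF \<zeta> connected_frontier sub])
  have "z \<in> connected_component_set (- K) \<zeta>" if z: "z \<notin> K" for z
  proof (cases "connected_component_set (- K) z \<inter> frontier D = {}")
    case False
    then show ?thesis
      using \<open>frontier D \<subseteq> connected_component_set (- K) \<zeta>\<close> z
      using connected_component_nonoverlap[of "- K" z \<zeta>] connected_component_refl[of z "- K"] by blast
  next
    case True
    define W where "W = connected_component_set (- K) z"
    have W: "closure W \<subseteq> D" "frontier W \<subseteq> K"
      using component_avoiding_frontier[OF K z W_def] True by (simp_all add: W_def)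
    have zW: "z \<in> W" using z by (simp add: W_def)
    have "0 \<le> Re (g z - e)"
    proof (rule Phragmen_Lindelof_D[OF _ W(1) open_D order_refl _ _ _ zW])
      show "open W" unfolding W_def using K by (simp add: open_connected_component open_Compl)
      show "(\<lambda>z. g z - e) holomorphic_on D" using holomorphic_g by (intro holomorphic_intros)
      show "- e \<le> Re (g w - e)" if "w \<in> W" for w
        using that W(1) closure_subset[of W] Re_g_pos[of w] by auto
      show "0 \<le> Re (g w - e)" if "w \<in> frontier W" for w
      proof -
        have "w \<in> K" using that W(2) by blast
        then show ?thesis using u_D[of w] K(2) by (auto simp: K_def)
      qed
    qed
    moreover have "z \<in> D" using W zW closure_subset by blast
    ultimately have "z \<in> K" by (simp add: K_def u_D)
    with z show ?thesis by simp
  qed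
  then have "- K = connected_component_set (- K) \<zeta>"
    using connected_component_subset by blast
  then show ?thesis
    unfolding mK[symmetric] by (metis connected_connected_component)
qed

text \<open>
  On a bounded component \<open>u\<close> would be bounded above and equal to \<open>e\<close> on the frontier.
\<close>

lemma superlevel_component_unbounded:
  assumes "0 < e" "e < u a"
  shows "\<not> bounded (connected_component_set {z. e < u z} a)"
proof
  define A where "A = connected_component_set {z. e < u z} a"
  assume "bounded (connected_component_set {z. e < u z} a)"
  then have "bounded A" by (simp add: A_def)
  have aA: "a \<in> A" using assms by (simp add: A_def)
  have op: "open A" unfolding A_def by (intro open_connected_component open_superlevel)
  have AP: "A \<subseteq> {z. e < u z}" unfolding A_def by (rule connected_component_subset)
  have "closure A \<subseteq> {z. e \<le> u z}"
    using AP closed_superlevel by (intro closure_minimal) auto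
  then have clA: "closure A \<subseteq> D" using superlevel_subset[OF assms(1)] by blast
  have fr: "u x = e" if x: "x \<in> frontier A" for x
  proof -
    have "e \<le> u x" using x \<open>closure A \<subseteq> {z. e \<le> u z}\<close> by (auto simp: frontier_def)
    moreover have "\<not> e < u x"
      using frontier_component_open[OF open_superlevel[of e], of a] x by (auto simp: A_def)
    ultimately show ?thesis by simp
  qed
  have "compact (u ` closure A)"
    using \<open>bounded A\<close> continuous_u by (intro compact_continuous_image) (auto simp: compact_closure)
  then obtain M where M: "\<And>z. z \<in> closure A \<Longrightarrow> \<bar>u z\<bar> \<le> M"
    using compact_imp_bounded[of "u ` closure A"] by (auto simp: bounded_iff)
  have "0 \<le> Re (e - g a)"
  proof (rule Phragmen_Lindelof_D[OF op clA open_D order_refl _ _ _ aA])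
    show "(\<lambda>z. e - g z) holomorphic_on D" using holomorphic_g by (intro holomorphic_intros)
    show "- M \<le> Re (e - g w)" if "w \<in> A" for w
    proof -
      have "w \<in> closure A" using that closure_subset by blast
      then show ?thesis using M[of w] u_D[of w] clA assms(1) by auto
    qed
    show "0 \<le> Re (e - g w)" if "w \<in> frontier A" for w
      using fr[OF that] that clA u_D[of w] by (auto simp: frontier_def)
  qed
  then show False using assms u_D[of a] clA aA closure_subset by force
qed

text \<open>
  Let \<open>l\<close> be a branch of the logarithm of \<open>z - a\<close>. On \<open>\<bar>z - a\<bar> > 1\<close> the harmonic function \<open>Re (1 / l)\<close> is
  positive, and it tends to \<open>0\<close> at \<open>\<infinity>\<close>, however much the argument of \<open>z - a\<close> may vary. A multiple
  of it, added to \<open>u - e1\<close>, makes up for the bounded part \<open>S\<close> of the frontier, where nothing is known about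
  \<open>u\<close>: a large circle is used in its place, which meets the closed set \<open>X \<subseteq> D\<close> in a compact set.
\<close>

lemma far_superlevel:
  assumes "closed X" "X \<subseteq> D" "0 < e" "e < e1" "bounded S"
    and fr: "\<And>z. z \<in> frontier X \<Longrightarrow> z \<notin> S \<Longrightarrow> e1 \<le> u z"
  obtains r where "\<And>z. z \<in> X \<Longrightarrow> r \<le> norm z \<Longrightarrow> e < u z"
proof -
  obtain a where a: "a \<notin> D" using D_not_UNIV by blast
  have "(\<lambda>z. z - a) holomorphic_on D" "\<forall>z\<in>D. z - a \<noteq> 0"
    using a by (auto intro!: holomorphic_intros)
  then obtain l where l: "l holomorphic_on D" "\<And>z. z \<in> D \<Longrightarrow> z - a = exp (l z)"
    using simply_connected_D simply_connected_eq_holomorphic_log[OF open_D] by blast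
  have Re_l: "Re (l z) = ln (norm (z - a))" if "z \<in> D" for z
    using l(2)[OF that] by simp
  have Re_l_pos: "0 < Re (l z)" if "z \<in> D" "1 < norm (z - a)" for z
    using Re_l[OF that(1)] ln_gt_zero[OF that(2)] by simp
  have Re_inv: "0 < Re (1 / l z)" "Re (1 / l z) \<le> 1 / ln (norm (z - a))"
    if "z \<in> D" "1 < norm (z - a)" for z
  proof -
    have pos: "0 < Re (l z)" using Re_l_pos[OF that] .
    then show "0 < Re (1 / l z)"
      by (auto simp: Re_divide intro!: divide_pos_pos add_pos_nonneg)
    have "Re (1 / l z) \<le> norm (1 / l z)" by (rule complex_Re_le_cmod)
    also have "\<dots> \<le> 1 / Re (l z)"
      using pos complex_Re_le_cmod[of "l z"] by (simp add: norm_divide frac_le)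
    finally show "Re (1 / l z) \<le> 1 / ln (norm (z - a))" using Re_l[OF that(1)] by simp
  qed
  define U where "U = D - cball a 1"
  have U: "open U" "U \<subseteq> D" using open_D by (auto simp: U_def open_Diff)
  have lU: "l z \<noteq> 0" if "z \<in> U" for z
    using Re_l_pos[of z] that by (auto simp: U_def dist_norm norm_minus_commute)
  have hol_inv: "(\<lambda>z. 1 / l z) holomorphic_on U"
    using holomorphic_on_subset[OF l(1) U(2)] lU by (intro holomorphic_intros)
  obtain r0 where r0: "r0 > 1" "S \<subseteq> ball a r0"
  proof -
    obtain b where "S \<subseteq> ball a b" using \<open>bounded S\<close> bounded_subset_ballD by blast
    then have "S \<subseteq> ball a (max b 2)" by auto
    then show thesis using that[of "max b 2"] by simp
  qed
  obtain c where c: "c > 0" "\<And>z. z \<in> X \<inter> sphere a r0 \<Longrightarrow> c \<le> Re (1 / l z)"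
  proof (cases "X \<inter> sphere a r0 = {}")
    case False
    have sub: "X \<inter> sphere a r0 \<subseteq> U" using assms(2) r0 by (auto simp: U_def)
    have "compact (X \<inter> sphere a r0)" using assms(1) by (simp add: closed_Int_compact)
    moreover have "continuous_on (X \<inter> sphere a r0) (\<lambda>z. Re (1 / l z))"
      by (intro continuous_on_Re continuous_on_subset[OF holomorphic_on_imp_continuous_on[OF hol_inv]] sub)
    ultimately obtain p where p: "p \<in> X \<inter> sphere a r0"
      "\<And>z. z \<in> X \<inter> sphere a r0 \<Longrightarrow> Re (1 / l p) \<le> Re (1 / l z)"
      using continuous_attains_inf[OF _ False] by blast
    have "0 < Re (1 / l p)"
      using p(1) assms(2) r0(1) by (intro Re_inv) (auto simp: dist_norm norm_minus_commute)
    with p(2) show thesis using that by blast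
  qed (use that[of 1] in auto)
  define W where "W = interior X - cball a r0"
  \<comment> \<open>\<open>\<kappa> Re (1 / l) \<ge> e1\<close> on the part of the circle that lies in \<open>X\<close>.\<close>
  define \<kappa> where "\<kappa> = e1 / c"
  define h where "h = (\<lambda>z. g z - of_real e1 + of_real \<kappa> * (1 / l z))"
  have "Re (w - of_real e1 + of_real \<kappa> * x) = Re w - e1 + \<kappa> * Re x" for w x :: complex
    by simp
  then have Re_h: "Re (h z) = Re (g z) - e1 + \<kappa> * Re (1 / l z)" for z
    unfolding h_def .
  have WX: "W \<subseteq> X" using interior_subset by (auto simp: W_def)
  have "closure W \<subseteq> X \<inter> - ball a r0"
    using WX \<open>closed X\<close> by (intro closure_minimal) (auto simp: W_def closed_Compl closed_Int)
  then have clW: "z \<in> X" "z \<notin> ball a r0" if "z \<in> closure W" for z using that by auto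
  then have clWU: "closure W \<subseteq> U" using assms(2) r0(1) by (force simp: U_def)
  have e1: "0 < e1" and \<kappa>: "0 < \<kappa>" "\<kappa> * c = e1" using assms c(1) by (simp_all add: \<kappa>_def)
  have bound: "0 \<le> Re (h z)" if z: "z \<in> W" for z
  proof (rule Phragmen_Lindelof_D[OF _ clWU U _ _ _ z])
    show "open W" by (simp add: W_def open_Diff)
    show "h holomorphic_on U"
      unfolding h_def
      by (intro holomorphic_on_add holomorphic_on_diff holomorphic_on_mult holomorphic_on_const
          holomorphic_on_subset[OF holomorphic_g U(2)] hol_inv)
    show "- e1 \<le> Re (h w)" if w: "w \<in> W" for w
    proof -
      have "w \<in> D" using w WX assms(2) by blast
      moreover have "1 < norm (w - a)"
        using w r0(1) by (auto simp: W_def dist_norm norm_minus_commute)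
      ultimately have "0 < Re (g w)" "0 < \<kappa> * Re (1 / l w)"
        using Re_g_pos Re_inv(1) \<kappa>(1) by auto
      then show ?thesis unfolding Re_h by linarith
    qed
    show "0 \<le> Re (h w)" if w: "w \<in> frontier W" for w
    proof -
      have wcl: "w \<in> closure W" using w by (simp add: frontier_def)
      have wD: "w \<in> D" using clW[OF wcl] assms(2) by blast
      have Reh: "Re (h w) = u w - e1 + \<kappa> * Re (1 / l w)"
        unfolding u_D[OF wD] by (rule Re_h)
      have "0 < u w" using Re_g_pos[OF wD] u_D[OF wD] by simp
      have "1 < norm (w - a)"
        using clW(2)[OF wcl] r0(1) by (auto simp: dist_norm norm_minus_commute)
      then have pos: "0 < \<kappa> * Re (1 / l w)" using Re_inv(1)[OF wD] \<kappa>(1) by simp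
      show ?thesis
      proof (cases "w \<in> sphere a r0")
        case True
        then have "c \<le> Re (1 / l w)" using c(2) clW[OF wcl] by blast
        then have "\<kappa> * c \<le> \<kappa> * Re (1 / l w)"
          using \<kappa>(1) by (intro mult_left_mono) auto
        then show ?thesis using Reh \<open>0 < u w\<close> \<kappa>(2) by simp
      next
        case False
        then have out: "w \<in> - cball a r0" using clW(2)[OF wcl] by auto
        have "W = interior X \<inter> - cball a r0" by (auto simp: W_def)
        then have "w \<notin> interior X"
          using w out by (auto simp: frontier_def interior_open open_Int open_Compl)
        then have "w \<in> frontier X" using clW(1)[OF wcl] closure_subset by (auto simp: frontier_def)
        moreover have "w \<notin> S" using r0(2) clW(2)[OF wcl] by blast
        ultimately have "e1 \<le> u w" by (rule fr)
        then show ?thesis using Reh pos by linarith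
      qed
    qed
  qed
  define N where "N = \<kappa> / (e1 - e) + 1"
  have Npos: "0 < N" using assms(4) \<kappa>(1) by (simp add: N_def add_pos_pos)
  show thesis
  proof
    fix z assume z: "z \<in> X" "norm a + r0 + exp N \<le> norm z"
    have zD: "z \<in> D" using z assms(2) by blast
    have far: "r0 + exp N \<le> norm (z - a)" using z norm_triangle_ineq2[of z a] by linarith
    show "e < u z"
    proof (cases "z \<in> interior X")
      case False
      then have "z \<in> frontier X" using z(1) closure_subset by (auto simp: frontier_def)
      moreover have "z \<notin> ball a r0"
      proof -
        have "r0 \<le> norm (z - a)" using far exp_gt_zero[of N] by linarith
        then show ?thesis by (simp add: dist_norm norm_minus_commute)
      qed
      then have "z \<notin> S" using r0(2) by blast
      ultimately show ?thesis using fr assms(4) by fastforce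
    next
      case True
      have "r0 < norm (z - a)" using far exp_gt_zero[of N] by linarith
      then have "z \<in> W" using True by (simp add: W_def dist_norm norm_minus_commute)
      then have "0 \<le> Re (h z)" by (rule bound)
      moreover have "Re (h z) = u z - e1 + \<kappa> * Re (1 / l z)"
        unfolding u_D[OF zD] by (rule Re_h)
      moreover have "\<kappa> * Re (1 / l z) < e1 - e"
      proof -
        have ge: "exp N \<le> norm (z - a)" "1 < norm (z - a)" using far r0(1) exp_gt_zero[of N] by linarith+
        then have "N \<le> ln (norm (z - a))" by (subst ln_ge_iff) auto
        then have "Re (1 / l z) \<le> 1 / N"
          using Re_inv(2)[OF zD ge(2)] Npos by (meson frac_le order.refl order.trans zero_le_one)
        then have "\<kappa> * Re (1 / l z) \<le> \<kappa> * (1 / N)"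
          using \<kappa>(1) by (intro mult_left_mono) auto
        also have "\<kappa> * (1 / N) < e1 - e"
        proof -
          have "\<kappa> / (e1 - e) < N" by (simp add: N_def)
          then have "\<kappa> < N * (e1 - e)" using assms(4) by (simp add: pos_divide_less_eq)
          then show ?thesis using Npos by (simp add: pos_divide_less_eq mult.commute)
        qed
        finally show ?thesis .
      qed
      ultimately show ?thesis by linarith
    qed
  qed
qed

text \<open>
  Two components of \<open>{u > e}\<close> would give the closed set \<open>X\<close>, with connected complement, two ends. Here \<open>X\<close>
  consists of \<open>K\<close>, which contains an unbounded part of each component and a path joining these parts, and
  of all components of the complement of \<open>K\<close> but the one that contains \<open>frontier D\<close>. The level \<open>e1\<close> leaves
  room for the small loss between the frontier of \<open>X\<close> and \<open>X\<close> itself.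
\<close>

lemma connected_superlevel:
  assumes e: "0 < e"
  shows "connected {z. e < u z}"
proof (rule ccontr)
  define P where "P = {z. e < u z}"
  assume "\<not> connected {z. e < u z}"
  then obtain a b where ab: "a \<in> P" "b \<in> P" "\<not> connected_component P a b"
    unfolding P_def connected_iff_connected_component by blast
  define A where "A = connected_component_set P a"
  have "e < min (u a) (u b)" using ab by (simp add: P_def)
  then obtain e1 where e1: "e < e1" "e1 < u a" "e1 < u b" using dense by (metis min_less_iff_conj)
  define A1 where "A1 = connected_component_set {z. e1 < u z} a"
  define B1 where "B1 = connected_component_set {z. e1 < u z} b"
  have sub: "{z. e1 < u z} \<subseteq> P" using e1 by (auto simp: P_def)
  have A1: "A1 \<subseteq> A" "a \<in> A1" "connected A1" "\<not> bounded A1"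
    using connected_component_mono[OF sub] e e1 superlevel_component_unbounded[of e1 a]
    by (auto simp: A1_def A_def)
  have B1: "B1 \<subseteq> connected_component_set P b" "b \<in> B1" "connected B1" "\<not> bounded B1"
    using connected_component_mono[OF sub] e e1 superlevel_component_unbounded[of e1 b]
    by (auto simp: B1_def)
  have B1A: "B1 \<inter> A = {}"
  proof -
    have "A \<inter> connected_component_set P b = {}"
      unfolding A_def using ab(3) by (simp add: connected_component_disjoint connected_component_sym_eq)
    then show ?thesis using B1(1) by blast
  qed
  have abD: "a \<in> D" "b \<in> D" using ab superlevel_subset[OF e] by (force simp: P_def)+
  obtain \<sigma> where \<sigma>: "path \<sigma>" "path_image \<sigma> \<subseteq> D" "pathstart \<sigma> = a" "pathfinish \<sigma> = b"
    using connected_D open_D abD by (metis connected_open_path_connected path_connected_def)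
  define S where "S = path_image \<sigma>"
  have S: "compact S" "connected S" "a \<in> S" "b \<in> S" "S \<subseteq> D"
    using \<sigma> by (auto simp: S_def compact_path_image connected_path_image)
  define K where "K = {z. e1 \<le> u z} \<union> S"
  have K: "closed K" "K \<subseteq> D"
    using closed_superlevel[of e1] S superlevel_subset[of e1] e e1 by (auto simp: K_def compact_imp_closed)
  obtain \<zeta> where \<zeta>: "\<zeta> \<in> frontier D" using frontier_nonempty by blast
  define V where "V = connected_component_set (- K) \<zeta>"
  have "frontier D \<subseteq> - K" using frontier_disjoint K by blast
  then have frV: "frontier D \<subseteq> V"
    unfolding V_def using \<zeta> connected_frontier by (intro connected_component_maximal) auto
  have opV: "open V" unfolding V_def using K by (simp add: open_connected_component open_Compl)
  define X where "X = - V"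
  have "closed X" using opV by (simp add: X_def closed_Compl)
  have KX: "K \<subseteq> X" using connected_component_subset by (force simp: X_def V_def)
  have XD: "X \<subseteq> D"
  proof
    fix z assume z: "z \<in> X"
    show "z \<in> D"
    proof (cases "z \<in> K")
      case False
      define W where "W = connected_component_set (- K) z"
      have "W \<inter> frontier D = {}"
      proof (rule ccontr)
        assume "W \<inter> frontier D \<noteq> {}"
        then have "W \<inter> V \<noteq> {}" using frV by blast
        then have "W = V" unfolding W_def V_def using connected_component_nonoverlap by blast
        then show False using z False by (auto simp: X_def W_def)
      qed
      then have "closure W \<subseteq> D" by (rule component_avoiding_frontier(1)[OF K False W_def])
      moreover have "z \<in> W" using False by (simp add: W_def)
      ultimately show ?thesis using closure_subset by blast
    qed (use K in auto)
  qed
  have frX: "e1 \<le> u z" if "z \<in> frontier X" "z \<notin> S" for z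
  proof -
    have "z \<notin> - K"
      using that(1) frontier_component_open[OF open_Compl[OF K(1)], of \<zeta>]
      by (auto simp: X_def V_def frontier_complement)
    then show ?thesis using that(2) by (auto simp: K_def)
  qed
  obtain r where r: "\<And>z. z \<in> X \<Longrightarrow> r \<le> norm z \<Longrightarrow> e < u z"
    using far_superlevel[OF \<open>closed X\<close> XD e e1(1) compact_imp_bounded[OF S(1)] frX] by blast
  obtain T where T: "closed T" "A = P \<inter> T"
    using closedin_connected_component[of P a] unfolding A_def closedin_closed by blast
  have opA: "open A" unfolding A_def P_def by (intro open_connected_component open_superlevel)
  define Y1 where "Y1 = (X - ball 0 r) \<inter> T"
  define Y2 where "Y2 = (X - ball 0 r) - A"
  have far: "X - ball 0 r \<subseteq> P" using r by (auto simp: P_def)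
  have Y1: "Y1 = (X - ball 0 r) \<inter> A" using far T(2) by (auto simp: Y1_def)
  have A1X: "A1 \<subseteq> X" and B1X: "B1 \<subseteq> X"
    using KX connected_component_subset[of "{z. e1 < u z}"] by (force simp: K_def A1_def B1_def)+
  define Q where "Q = A1 \<union> S \<union> B1"
  show False
  proof (rule connected_complement_one_end[OF \<open>closed X\<close>])
    show "connected (- X)" by (simp add: X_def V_def)
    show "X \<noteq> UNIV" using frV \<zeta> by (auto simp: X_def)
    show "closed Y1" "closed Y2"
      using \<open>closed X\<close> T(1) opA by (auto simp: Y1_def Y2_def intro!: closed_Int closed_Diff)
    show "Y1 \<inter> Y2 = {}" "X - ball 0 r \<subseteq> Y1 \<union> Y2" by (auto simp: Y1 Y2_def)
    show "connected Q"
      unfolding Q_def using A1 B1 S by (intro connected_Un) auto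
    show "Q \<subseteq> X" using A1X B1X KX by (auto simp: Q_def K_def)
    have "A1 \<subseteq> (Q \<inter> Y1) \<union> ball 0 r" using A1(1) A1X by (auto simp: Q_def Y1)
    then show "\<not> bounded (Q \<inter> Y1)" using A1(4) bounded_ball bounded_subset bounded_Un by metis
    have "B1 \<subseteq> (Q \<inter> Y2) \<union> ball 0 r" using B1A B1X by (auto simp: Q_def Y2_def)
    then show "\<not> bounded (Q \<inter> Y2)" using B1(4) bounded_ball bounded_subset bounded_Un by metis
  qed
qed

section \<open>Level sets are connected, and the map is injective\<close>

text \<open>
  Near \<open>z\<close> the open map \<open>g\<close> takes values on both sides of the vertical line through \<open>g z\<close>.
\<close>

lemma level_in_closures:
  assumes "0 < e" "u z = e"
  shows "z \<in> closure {z. u z < e}" "z \<in> closure {z. e < u z}"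
proof -
  have zD: "z \<in> D" using assms superlevel_subset by fastforce
  have near: "\<exists>d>0. \<forall>w. dist w (g z) < d \<longrightarrow> (\<exists>x\<in>D. dist x z < \<delta> \<and> g x = w)" if "\<delta> > 0" for \<delta>
  proof -
    have "open (g ` (D \<inter> ball z \<delta>))" using open_D by (intro open_image_g) auto
    moreover have "g z \<in> g ` (D \<inter> ball z \<delta>)" using zD that by auto
    ultimately obtain d where d: "d > 0" "ball (g z) d \<subseteq> g ` (D \<inter> ball z \<delta>)" using openE by blast
    have "\<exists>x\<in>D. dist x z < \<delta> \<and> g x = w" if "dist w (g z) < d" for w
    proof -
      have "w \<in> g ` (D \<inter> ball z \<delta>)" using d(2) that by (auto simp: dist_commute)
      then show ?thesis by (auto simp: dist_commute)
    qed
    then show ?thesis using d(1) by blast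
  qed
  show "z \<in> closure {z. u z < e}"
    unfolding closure_approachable
  proof (intro allI impI)
    fix \<delta> :: real assume "0 < \<delta>"
    from near[OF this] obtain d where d: "d > 0" "\<And>w. dist w (g z) < d \<Longrightarrow> \<exists>x\<in>D. dist x z < \<delta> \<and> g x = w"
      by blast
    obtain x where "x \<in> D" "dist x z < \<delta>" "g x = g z - of_real (d/2)"
      using d(2)[of "g z - of_real (d/2)"] d(1) by (auto simp: dist_norm)
    then show "\<exists>y\<in>{z. u z < e}. dist y z < \<delta>"
      using assms(2) u_D zD d(1) by (intro bexI[of _ x]) auto
  qed
  show "z \<in> closure {z. e < u z}"
    unfolding closure_approachable
  proof (intro allI impI)
    fix \<delta> :: real assume "0 < \<delta>"
    from near[OF this] obtain d where d: "d > 0" "\<And>w. dist w (g z) < d \<Longrightarrow> \<exists>x\<in>D. dist x z < \<delta> \<and> g x = w"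
      by blast
    obtain x where "x \<in> D" "dist x z < \<delta>" "g x = g z + of_real (d/2)"
      using d(2)[of "g z + of_real (d/2)"] d(1) by (auto simp: dist_norm)
    then show "\<exists>y\<in>{z. e < u z}. dist y z < \<delta>"
      using assms(2) u_D zD d(1) by (intro bexI[of _ x]) auto
  qed
qed

text \<open>
  Unicoherence of the plane: two connected closed sets that cover it have connected intersection.
\<close>

lemma connected_level:
  assumes "0 < e"
  shows "connected {z. u z = e}"
proof -
  have cl1: "closure {z. u z < e} = {z. u z \<le> e}"
  proof
    show "closure {z. u z < e} \<subseteq> {z. u z \<le> e}"
      using closed_sublevel by (intro closure_minimal) auto
    show "{z. u z \<le> e} \<subseteq> closure {z. u z < e}"
      using level_in_closures(1)[OF assms] closure_subset[of "{z. u z < e}"] by (force simp: order_le_less)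
  qed
  have cl2: "closure {z. e < u z} = {z. e \<le> u z}"
  proof
    show "closure {z. e < u z} \<subseteq> {z. e \<le> u z}"
      using closed_superlevel by (intro closure_minimal) auto
    show "{z. e \<le> u z} \<subseteq> closure {z. e < u z}"
      using level_in_closures(2)[OF assms] closure_subset[of "{z. e < u z}"] by (force simp: order_le_less)
  qed
  have "connected ({z. u z \<le> e} \<inter> {z. e \<le> u z})"
  proof (rule unicoherentD[OF unicoherent_UNIV])
    show "connected {z. u z \<le> e}"
      using connected_imp_connected_closure[OF connected_sublevel[OF assms]] by (simp add: cl1)
    show "connected {z. e \<le> u z}"
      using connected_imp_connected_closure[OF connected_superlevel[OF assms]] by (simp add: cl2)
  qed (use closed_sublevel closed_superlevel in auto)
  moreover have "{z. u z \<le> e} \<inter> {z. e \<le> u z} = {z. u z = e}" by auto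
  ultimately show ?thesis by simp
qed

text \<open>
  The level set is connected and, by local inverses of \<open>g\<close>, locally a vertical segment; so any two of its
  points are joined by an arc. If \<open>g\<close> took the same value at both ends, \<open>Im g\<close> would have an extremum
  inside the arc, and could not be injective nearby. But it is, since \<open>Re g\<close> is constant on the arc.
\<close>

lemma inj_on_noncritical_level:
  assumes e: "0 < e" and reg: "\<And>z. u z = e \<Longrightarrow> deriv g z \<noteq> 0"
  shows "inj_on g {z. u z = e}"
proof -
  define L where "L = {z. u z = e}"
  have LD: "L \<subseteq> D" using superlevel_subset[OF e] by (auto simp: L_def)
  have Lg: "Re (g z) = e" if "z \<in> L" for z using that LD u_D by (auto simp: L_def)
  have loc: "\<exists>r>0. ball z r \<subseteq> D \<inter> B \<and> open (g ` ball z r) \<and> inj_on g (ball z r)"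
    if z: "z \<in> L" "open B" "z \<in> B" for z B
  proof -
    have "g holomorphic_on (D \<inter> B)" using holomorphic_g by (rule holomorphic_on_subset) auto
    moreover have "z \<in> D \<inter> B" "open (D \<inter> B)" using z LD open_D by auto
    moreover have "deriv g z \<noteq> 0" using reg z(1) by (simp add: L_def)
    ultimately show ?thesis using has_complex_derivative_locally_invertible by metis
  qed
  have "locally path_connected L"
  proof (rule locally_path_connected_1)
    fix v x assume v: "openin (top_of_set L) v" "x \<in> v"
    then obtain B where B: "open B" "v = L \<inter> B" by (auto simp: openin_open)
    then have x: "x \<in> L" "x \<in> B" using v(2) by auto
    obtain r where r: "r > 0" "ball x r \<subseteq> D \<inter> B" "open (g ` ball x r)" "inj_on g (ball x r)"
      using loc[OF x(1) B(1) x(2)] by blast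
    have holr: "g holomorphic_on ball x r"
      using holomorphic_g by (rule holomorphic_on_subset) (use r(2) in blast)
    obtain k where k: "k holomorphic_on (g ` ball x r)" "\<And>z. z \<in> ball x r \<Longrightarrow> k (g z) = z"
      using holomorphic_has_inverse[OF holr open_ball r(4)] by metis
    have "g x \<in> g ` ball x r" using r(1) by simp
    then obtain s where s: "s > 0" "ball (g x) s \<subseteq> g ` ball x r" using r(3) openE by blast
    define I where "I = ball (g x) s \<inter> {w. Re w = e}"
    define O' where "O' = ball x r \<inter> g -` ball (g x) s"
    have "open O'"
      unfolding O'_def
      using continuous_on_open_vimage[OF open_ball, of x r g] holomorphic_on_imp_continuous_on[OF holr]
      by (metis Int_commute open_ball)
    have eq: "k ` I = L \<inter> O'"
    proof (intro equalityI subsetI)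
      fix z assume "z \<in> k ` I"
      then obtain w where w: "w \<in> I" "z = k w" by blast
      then obtain y where y: "y \<in> ball x r" "w = g y" using s(2) by (auto simp: I_def)
      then have "z = y" using w(2) k(2) by simp
      moreover have "y \<in> D" using y(1) r(2) by blast
      ultimately show "z \<in> L \<inter> O'"
        using y w(1) u_D[of y] by (auto simp: I_def L_def O'_def)
    next
      fix z assume z: "z \<in> L \<inter> O'"
      then have "g z \<in> I" using Lg[of z] by (auto simp: I_def O'_def)
      moreover have "k (g z) = z" using z k(2) by (auto simp: O'_def)
      ultimately show "z \<in> k ` I" by (metis image_eqI)
    qed
    have "convex {w. Re w = e}"
      using convex_hyperplane[of "1::complex" e] by (simp add: inner_complex_def)
    then have "convex I" unfolding I_def by (intro convex_Int convex_ball)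
    then have "path_connected I" by (rule convex_imp_path_connected)
    moreover have "continuous_on I k"
      using holomorphic_on_imp_continuous_on[OF k(1)] by (rule continuous_on_subset) (use s(2) in \<open>auto simp: I_def\<close>)
    ultimately have "path_connected (k ` I)" by (intro path_connected_continuous_image)
    then show "\<exists>U. openin (top_of_set L) U \<and> path_connected U \<and> x \<in> U \<and> U \<subseteq> v"
      using \<open>open O'\<close> x r s B(2) unfolding eq
      by (intro exI[of _ "L \<inter> O'"]) (auto simp: openin_open O'_def)
  qed
  moreover have "connected L" unfolding L_def by (rule connected_level[OF e])
  ultimately have "path_connected L"
    by (metis path_component_eq_connected_component path_connected_component
        connected_iff_connected_component)
  show ?thesis
    unfolding L_def[symmetric]
  proof (rule inj_onI, rule ccontr)
    fix a b assume ab: "a \<in> L" "b \<in> L" "g a = g b" "a \<noteq> b"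
    obtain \<gamma> where \<gamma>: "arc \<gamma>" "path_image \<gamma> \<subseteq> L" "pathstart \<gamma> = a" "pathfinish \<gamma> = b"
      using \<open>path_connected L\<close> ab unfolding path_connected_arcwise by metis
    define \<phi> where "\<phi> = (\<lambda>t. Im (g (\<gamma> t)))"
    have cont\<gamma>: "continuous_on {0..1} \<gamma>" and inj\<gamma>: "inj_on \<gamma> {0..1}"
      using \<gamma>(1) by (auto simp: arc_def path_def)
    have \<gamma>L: "\<gamma> t \<in> L" if "t \<in> {0..1}" for t using that \<gamma>(2) by (auto simp: path_image_def)
    have cont\<phi>: "continuous_on {0..1} \<phi>"
      unfolding \<phi>_def
      by (intro continuous_on_Im continuous_on_compose2[OF continuous_g cont\<gamma>]) (use \<gamma>L LD in blast)
    have ends: "\<phi> 0 = \<phi> 1"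
      using \<gamma>(3,4) ab(3) by (simp add: \<phi>_def pathstart_def pathfinish_def)
    have no_extremum: False
      if t: "0 < t" "t < 1" and ext: "(\<forall>s\<in>{0..1}. \<phi> s \<le> \<phi> t) \<or> (\<forall>s\<in>{0..1}. \<phi> t \<le> \<phi> s)" for t
    proof -
      obtain r where r: "r > 0" "inj_on g (ball (\<gamma> t) r)"
        using loc[OF \<gamma>L[of t] open_UNIV] t by auto
      obtain d where d: "d > 0" "\<And>s. s \<in> {0..1} \<Longrightarrow> dist s t < d \<Longrightarrow> dist (\<gamma> s) (\<gamma> t) < r"
        using cont\<gamma> t r(1) unfolding continuous_on_iff by (metis atLeastAtMost_iff less_imp_le)
      define \<delta> where "\<delta> = Min {d / 2, t, 1 - t}"
      have \<delta>: "0 < \<delta>" "\<delta> < d" "\<delta> \<le> t" "\<delta> \<le> 1 - t" using d t by (auto simp: \<delta>_def min_def)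
      have sub: "{t - \<delta>..t + \<delta>} \<subseteq> {0..1}" using \<delta> by auto
      have "inj_on \<phi> {t - \<delta>..t + \<delta>}"
      proof (rule inj_onI)
        fix x y assume xy: "x \<in> {t - \<delta>..t + \<delta>}" "y \<in> {t - \<delta>..t + \<delta>}" "\<phi> x = \<phi> y"
        then have xy01: "x \<in> {0..1}" "y \<in> {0..1}" using sub by auto
        have "g (\<gamma> x) = g (\<gamma> y)"
          using xy(3) Lg[OF \<gamma>L[OF xy01(1)]] Lg[OF \<gamma>L[OF xy01(2)]] by (simp add: complex_eq_iff \<phi>_def)
        moreover have "\<gamma> x \<in> ball (\<gamma> t) r" "\<gamma> y \<in> ball (\<gamma> t) r"
          using d(2)[OF xy01(1)] d(2)[OF xy01(2)] xy(1,2) \<delta>(2) by (auto simp: dist_real_def dist_commute)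
        ultimately have "\<gamma> x = \<gamma> y" using r(2) by (auto dest: inj_onD)
        then show "x = y" using inj\<gamma> xy01 by (auto dest: inj_onD)
      qed
      moreover have "continuous_on {t - \<delta>..t + \<delta>} \<phi>" using cont\<phi> sub by (rule continuous_on_subset)
      ultimately have "(\<phi> (t - \<delta>) < \<phi> t \<and> \<phi> t < \<phi> (t + \<delta>)) \<or> (\<phi> (t + \<delta>) < \<phi> t \<and> \<phi> t < \<phi> (t - \<delta>))"
        using \<delta>(1) by (intro continuous_inj_imp_mono) auto
      moreover have "t - \<delta> \<in> {0..1}" "t + \<delta> \<in> {0..1}" using sub \<delta>(1) by auto
      ultimately show False using ext by (metis less_asym' not_less)
    qed
    obtain p where p: "p \<in> {0..1}" "\<And>s. s \<in> {0..1} \<Longrightarrow> \<phi> s \<le> \<phi> p"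
      using continuous_attains_sup[OF _ _ cont\<phi>] by auto
    obtain q where q: "q \<in> {0..1}" "\<And>s. s \<in> {0..1} \<Longrightarrow> \<phi> q \<le> \<phi> s"
      using continuous_attains_inf[OF _ _ cont\<phi>] by auto
    have "p = 0 \<or> p = 1" using no_extremum[of p] p by force
    moreover have "q = 0 \<or> q = 1" using no_extremum[of q] q by force
    ultimately have "\<phi> p = \<phi> q" using ends by auto
    then have "\<phi> s = \<phi> p" if "s \<in> {0..1}" for s using p(2)[OF that] q(2)[OF that] by simp
    then show False using no_extremum[of "1/2"] by simp
  qed
qed

lemma countable_critical_points: "countable {z\<in>D. deriv g z = 0}"
proof (rule ccontr)
  assume unc: "\<not> ?thesis"
  have "fsigma D"
    using open_Union_compact_subsets[OF open_D] by (metis fsigma_Union_compact image_subsetI mem_Collect_eq)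
  then have "D \<subseteq> {z\<in>D. deriv g z = 0}"
    using holomorphic_countable_equal[of "deriv g" D "\<lambda>_. 0"] unc holomorphic_g open_D connected_D
    by (simp add: holomorphic_deriv)
  then have "(g has_field_derivative 0) (at z)" if "z \<in> D" for z
    using holomorphic_derivI[OF holomorphic_g open_D that, of UNIV] that by auto
  then have "g constant_on D"
    using DERIV_zero_connected_constant[OF connected_D open_D finite.emptyI continuous_g]
    by (metis Diff_empty constant_on_def)
  then show False using g_not_constant[OF open_D order_refl D_nonempty] by simp
qed

text \<open>
  If \<open>g\<close> takes a value twice, then by openness it takes all nearby values twice, and some of these lie on a
  noncritical level.
\<close>

lemma inj_on_g: "inj_on g D"
proof (rule inj_onI, rule ccontr)
  fix a b assume ab: "a \<in> D" "b \<in> D" "g a = g b" "a \<noteq> b"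
  obtain U V where UV: "open U" "open V" "a \<in> U" "b \<in> V" "U \<inter> V = {}"
    using hausdorff[OF ab(4)] by blast
  define N where "N = g ` (D \<inter> U) \<inter> g ` (D \<inter> V)"
  have "open N" unfolding N_def using UV open_D by (intro open_Int open_image_g) auto
  moreover have "g a \<in> g ` (D \<inter> U)" "g b \<in> g ` (D \<inter> V)" using ab UV by blast+
  then have "g a \<in> N" using ab(3) by (simp add: N_def)
  ultimately obtain s where s: "s > 0" "ball (g a) s \<subseteq> N" using openE by blast
  define C where "C = (\<lambda>z. Re (g z)) ` {z\<in>D. deriv g z = 0}"
  have "countable C" unfolding C_def by (intro countable_image countable_critical_points)
  moreover have "uncountable {Re (g a)<..<Re (g a) + s}" using s(1) by (simp add: uncountable_open_interval)
  ultimately have "\<not> {Re (g a)<..<Re (g a) + s} \<subseteq> C" using countable_subset by blast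
  then obtain e where e: "e \<in> {Re (g a)<..<Re (g a) + s}" "e \<notin> C" by blast
  define w where "w = g a + of_real (e - Re (g a))"
  have Rew: "Re w = e" by (simp add: w_def)
  have "w \<in> ball (g a) s" using e(1) by (simp add: w_def dist_norm flip: of_real_diff)
  then have "w \<in> N" using s(2) by blast
  then obtain a' b' where ab': "a' \<in> D" "a' \<in> U" "g a' = w" "b' \<in> D" "b' \<in> V" "g b' = w"
    by (auto simp: N_def)
  have e0: "0 < e" using e(1) Re_g_pos[OF ab(1)] by simp
  have "inj_on g {z. u z = e}"
  proof (rule inj_on_noncritical_level[OF e0])
    fix z assume "u z = e"
    then have "z \<in> D" "Re (g z) = e" using superlevel_subset[OF e0] u_D by auto
    then show "deriv g z \<noteq> 0" using e(2) by (auto simp: C_def)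
  qed
  moreover have "u a' = e" "u b' = e" using ab' u_D Rew by auto
  ultimately have "a' = b'" using ab' by (auto dest: inj_onD)
  then show False using ab' UV by blast
qed

end

section \<open>The map is onto the half-plane\<close>

lemma cmod_diff_cnj_power2: "(norm (w + cnj c))\<^sup>2 - (norm (w - c))\<^sup>2 = 4 * Re w * Re c"
  unfolding cmod_power2 by (simp add: power2_eq_square algebra_simps)

lemma cmod_inverse_Blaschke_power2:
  "(norm (1 + cnj c * s))\<^sup>2 - (norm (s + c))\<^sup>2 = (1 - (norm s)\<^sup>2) * (1 - (norm c)\<^sup>2)"
  unfolding cmod_power2 by (simp add: power2_eq_square algebra_simps)

context half_plane_map
begin

text \<open>
  For an omitted value \<open>c\<close>, the Cayley transform \<open>T\<close> is zero-free and maps \<open>D\<close> into the unit disc, and its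
  square root \<open>s\<close> omits a ball around \<open>- s d\<close>. So the reciprocal \<open>F\<close> of the Blaschke factor with zero
  \<open>- s d\<close> is bounded on \<open>D\<close>. Its modulus exceeds 1 in \<open>D\<close> and tends to 1 at finite boundary points, because
  the modulus of \<open>T\<close> does, and \<open>- log F\<close> violates Phragmen--Lindelof.
\<close>

lemma image_g: "g ` D = {w. 0 < Re w}"
proof (rule ccontr)
  assume "g ` D \<noteq> {w. 0 < Re w}"
  then obtain c where c: "0 < Re c" "c \<notin> g ` D" using Re_g_pos by blast
  define T where "T = (\<lambda>z. (g z - c) / (g z + cnj c))"
  have den: "g z + cnj c \<noteq> 0" if "z \<in> D" for z
    using Re_g_pos[OF that] c(1) by (auto simp: complex_eq_iff)
  have "T holomorphic_on D"
    unfolding T_def using den holomorphic_g by (intro holomorphic_intros) auto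
  moreover have "\<forall>z\<in>D. T z \<noteq> 0" using c(2) den by (auto simp: T_def)
  ultimately obtain s where s: "s holomorphic_on D" "\<And>z. z \<in> D \<Longrightarrow> T z = (s z)\<^sup>2"
    using simply_connected_D simply_connected_eq_holomorphic_sqrt[OF open_D] by blast
  have s0: "s z \<noteq> 0" if "z \<in> D" for z
    using s(2)[OF that] den[OF that] that c(2) by (auto simp: T_def)
  have T_inj: "x = y" if "x \<in> D" "y \<in> D" "T x = T y" for x y
  proof -
    have "(g x - c) * (g y + cnj c) = (g y - c) * (g x + cnj c)"
      using that den by (simp add: T_def frac_eq_eq)
    then have "(g x - g y) * (c + cnj c) = 0" by (simp add: algebra_simps)
    moreover have "c + cnj c \<noteq> 0" using c(1) by (auto simp: complex_eq_iff)
    ultimately have "g x = g y" by simp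
    then show ?thesis using inj_on_g that by (auto dest: inj_onD)
  qed
  have "x = y" if "x \<in> D" "y \<in> D" "(s x)\<^sup>2 = (s y)\<^sup>2" for x y
    using T_inj that s(2) by metis
  then obtain d \<rho> where d: "d \<in> D" and \<rho>: "\<rho> > 0" and far: "\<And>z. z \<in> D \<Longrightarrow> \<rho> \<le> norm (s z + s d)"
    using square_root_omits_ball[OF open_D D_nonempty s(1) _ s0] by blast
  have T_bound: "1 - norm (T z) \<le> 4 * Re (g z) / Re c" "norm (T z) < 1" if z: "z \<in> D" for z
  proof -
    have pos: "0 < Re (g z)" using Re_g_pos[OF z] .
    have "Re c \<le> norm (g z + cnj c)"
      using complex_Re_le_cmod[of "g z + cnj c"] pos by simp
    then have n: "(Re c)\<^sup>2 \<le> (norm (g z + cnj c))\<^sup>2" "0 < (norm (g z + cnj c))\<^sup>2"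
      using c(1) by (auto intro: power_mono)
    have eq: "1 - (norm (T z))\<^sup>2 = 4 * Re (g z) * Re c / (norm (g z + cnj c))\<^sup>2"
    proof -
      have "1 - (norm (T z))\<^sup>2 = ((norm (g z + cnj c))\<^sup>2 - (norm (g z - c))\<^sup>2) / (norm (g z + cnj c))\<^sup>2"
        using n(2) unfolding T_def norm_divide power_divide by (simp add: diff_divide_distrib)
      then show ?thesis unfolding cmod_diff_cnj_power2 .
    qed
    also have "0 < \<dots>" using pos c(1) n(2) by simp
    finally have "(norm (T z))\<^sup>2 < 1\<^sup>2" by simp
    then show lt: "norm (T z) < 1" by (rule power2_less_imp_less) simp
    have "(norm (T z))\<^sup>2 \<le> norm (T z)"
      using lt by (simp add: power2_eq_square mult_left_le)
    then have "1 - norm (T z) \<le> 1 - (norm (T z))\<^sup>2" by simp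
    also have "\<dots> \<le> 4 * Re (g z) * Re c / (Re c)\<^sup>2"
      unfolding eq using n pos c(1) by (intro divide_left_mono) auto
    also have "\<dots> = 4 * Re (g z) / Re c" using c(1) by (simp add: power2_eq_square)
    finally show "1 - norm (T z) \<le> 4 * Re (g z) / Re c" .
  qed
  have norm_s: "(norm (s z))\<^sup>2 = norm (T z)" if "z \<in> D" for z
    using s(2)[OF that] by (simp add: norm_power)
  have norm_s1: "(norm (s z))\<^sup>2 < 1" if "z \<in> D" for z
    using norm_s[OF that] T_bound(2)[OF that] by simp
  define F where "F = (\<lambda>z. (1 + cnj (s d) * s z) / (s z + s d))"
  have den2: "s z + s d \<noteq> 0" if "z \<in> D" for z using far[OF that] \<rho> by auto
  have F2: "(norm (F z))\<^sup>2 = 1 + (1 - (norm (s z))\<^sup>2) * (1 - (norm (s d))\<^sup>2) / (norm (s z + s d))\<^sup>2"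
    if z: "z \<in> D" for z
  proof -
    have "(norm (F z))\<^sup>2 = ((norm (s z + s d))\<^sup>2 + (1 - (norm (s z))\<^sup>2) * (1 - (norm (s d))\<^sup>2)) / (norm (s z + s d))\<^sup>2"
      using cmod_inverse_Blaschke_power2[of "s d" "s z"]
      by (simp add: F_def norm_divide power_divide)
    then show ?thesis using den2[OF z] by (simp add: add_divide_distrib)
  qed
  have F_gt: "1 < (norm (F z))\<^sup>2" if z: "z \<in> D" for z
    unfolding F2[OF z] using norm_s1[OF z] norm_s1[OF d] den2[OF z] by simp
  have F_le: "(norm (F z))\<^sup>2 \<le> 1 + (1 - norm (T z)) / \<rho>\<^sup>2" if z: "z \<in> D" for z
  proof -
    have "(1 - (norm (s z))\<^sup>2) * (1 - (norm (s d))\<^sup>2) / (norm (s z + s d))\<^sup>2 \<le> (1 - (norm (s z))\<^sup>2) / \<rho>\<^sup>2"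
      using norm_s1[OF z] norm_s1[OF d] far[OF z] \<rho>
      by (intro frac_le power_mono mult_right_le_one_le) auto
    then show ?thesis unfolding F2[OF z] norm_s[OF z] by simp
  qed
  have "F holomorphic_on D"
    unfolding F_def using s(1) den2 by (intro holomorphic_intros) auto
  moreover have "\<forall>z\<in>D. F z \<noteq> 0" using F_gt by force
  ultimately obtain \<phi> where \<phi>: "\<phi> holomorphic_on D" "\<And>z. z \<in> D \<Longrightarrow> F z = exp (\<phi> z)"
    using simply_connected_D simply_connected_eq_holomorphic_log[OF open_D] by blast
  have Re_\<phi>: "2 * Re (\<phi> z) = ln ((norm (F z))\<^sup>2)" if "z \<in> D" for z
    using \<phi>(2)[OF that] by (simp add: ln_realpow)
  have \<phi>_le: "2 * Re (\<phi> z) \<le> (1 - norm (T z)) / \<rho>\<^sup>2" if z: "z \<in> D" for z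
  proof -
    have "2 * Re (\<phi> z) \<le> ln (1 + (1 - norm (T z)) / \<rho>\<^sup>2)"
      unfolding Re_\<phi>[OF z] using F_le[OF z] F_gt[OF z] by (subst ln_le_cancel_iff) auto
    also have "\<dots> \<le> (1 - norm (T z)) / \<rho>\<^sup>2"
      using T_bound(2)[OF z] by (intro ln_add_one_self_le_self) auto
    finally show ?thesis .
  qed
  have "0 \<le> Re (- \<phi> d)"
  proof (rule Phragmen_Lindelof[OF open_D simply_connected_D D_not_UNIV open_D order_refl _ _ _ d])
    show "(\<lambda>z. - \<phi> z) holomorphic_on D" using \<phi>(1) by (intro holomorphic_intros)
    show "- (1 / \<rho>\<^sup>2) \<le> Re (- \<phi> z)" if z: "z \<in> D" for z
    proof -
      have "0 < 2 * Re (\<phi> z)" unfolding Re_\<phi>[OF z] using F_gt[OF z] by (rule ln_gt_zero)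
      moreover have "(1 - norm (T z)) / \<rho>\<^sup>2 \<le> 1 / \<rho>\<^sup>2" by (intro divide_right_mono) auto
      ultimately show ?thesis using \<phi>_le[OF z] by simp
    qed
    show "eventually (\<lambda>z. - e < Re (- \<phi> z)) (at \<zeta> within D)"
      if \<zeta>: "\<zeta> \<in> frontier D" and e: "0 < e" for \<zeta> and e :: real
    proof -
      \<comment> \<open>Chosen so that \<open>Re g < \<eta>\<close> makes the bound \<open>4 Re g / (Re c \<rho>\<^sup>2)\<close> for \<open>2 Re \<phi>\<close> less than
        \<open>2 e\<close>.\<close>
      define \<eta> where "\<eta> = 2 * e * \<rho>\<^sup>2 * Re c / 4"
      have "0 < \<eta>" using e \<rho> c(1) by (simp add: \<eta>_def)
      then have "eventually (\<lambda>z. Re (g z) < \<eta>) (at \<zeta> within D)"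
        using Re_g_boundary[OF \<zeta>] by (intro order_tendstoD(2))
      with eventually_at_within_in[of D \<zeta>] show ?thesis
      proof eventually_elim
        case (elim z)
        have "2 * Re (\<phi> z) \<le> (4 * Re (g z) / Re c) / \<rho>\<^sup>2"
          using \<phi>_le[OF elim(1)] T_bound(1)[OF elim(1)] by (meson divide_right_mono order.trans zero_le_power2)
        also have "\<dots> < (4 * \<eta> / Re c) / \<rho>\<^sup>2"
          using elim(2) c(1) \<rho> by (intro divide_strict_right_mono) auto
        also have "\<dots> = 2 * e" using c(1) \<rho> by (simp add: \<eta>_def)
        finally show ?case by simp
      qed
    qed
  qed
  moreover have "0 < 2 * Re (\<phi> d)" unfolding Re_\<phi>[OF d] using F_gt[OF d] by (rule ln_gt_zero)
  ultimately show False by simp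
qed

end

section \<open>Covering maps\<close>

lemma covering_space_evenly_covered:
  assumes "covering_space C p S" "x \<in> S"
  obtains T v where "x \<in> T" "openin (top_of_set S) T" "\<Union>v = C \<inter> p -` T"
    "\<And>u. u \<in> v \<Longrightarrow> openin (top_of_set C) u" "pairwise disjnt v"
    "\<And>u. u \<in> v \<Longrightarrow> \<exists>q. homeomorphism u T p q"
proof -
  have "\<exists>T. x \<in> T \<and> openin (top_of_set S) T \<and> (\<exists>v. \<Union>v = C \<inter> p -` T \<and>
      (\<forall>u\<in>v. openin (top_of_set C) u) \<and> pairwise disjnt v \<and> (\<forall>u\<in>v. \<exists>q. homeomorphism u T p q))"
    using assms by (simp add: covering_space_def)
  then show thesis using that by (elim exE conjE) simp
qed

lemma covering_space_restrict:
  assumes "covering_space C p S" "S' \<subseteq> S"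
  shows "covering_space (C \<inter> p -` S') p S'"
proof
  show "continuous_on (C \<inter> p -` S') p"
    using covering_space_imp_continuous[OF assms(1)] by (rule continuous_on_subset) auto
  show "p ` (C \<inter> p -` S') = S'"
    using covering_space_imp_surjective[OF assms(1)] assms(2) by auto
  fix x assume x: "x \<in> S'"
  then obtain T v where T: "x \<in> T" "openin (top_of_set S) T"
    and v: "\<Union>v = C \<inter> p -` T" "\<And>u. u \<in> v \<Longrightarrow> openin (top_of_set C) u" "pairwise disjnt v"
      "\<And>u. u \<in> v \<Longrightarrow> \<exists>q. homeomorphism u T p q"
    using covering_space_evenly_covered[OF assms(1), of x] assms(2) by blast
  define v' where "v' = (\<lambda>u. u \<inter> p -` S') ` v"
  have "openin (top_of_set S') (T \<inter> S')"
    using T(2) assms(2) by (auto simp: openin_open)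
  moreover have "\<Union>v' = (C \<inter> p -` S') \<inter> p -` (T \<inter> S')"
    using v(1) by (auto simp: v'_def)
  moreover have "openin (top_of_set (C \<inter> p -` S')) w" if "w \<in> v'" for w
    using that v(2) by (force simp: v'_def openin_open)
  moreover have "pairwise disjnt v'"
    using v(3) unfolding v'_def pairwise_def disjnt_def by blast
  moreover have "\<exists>q. homeomorphism w (T \<inter> S') p q" if "w \<in> v'" for w
  proof -
    obtain u where u: "u \<in> v" "w = u \<inter> p -` S'" using \<open>w \<in> v'\<close> by (auto simp: v'_def)
    obtain q where q: "homeomorphism u T p q" using v(4)[OF u(1)] by blast
    have "homeomorphism w (T \<inter> S') p q"
    proof (rule homeomorphism_of_subsets[OF q])
      show "p ` w = T \<inter> S'"
        using homeomorphism_image1[OF q] u(2) by auto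
    qed (use u in auto)
    then show ?thesis by blast
  qed
  ultimately show "\<exists>T. x \<in> T \<and> openin (top_of_set S') T \<and>
      (\<exists>v. \<Union>v = C \<inter> p -` S' \<inter> p -` T \<and> (\<forall>u\<in>v. openin (top_of_set (C \<inter> p -` S')) u) \<and>
        pairwise disjnt v \<and> (\<forall>u\<in>v. \<exists>q. homeomorphism u T p q))"
    using x T(1) by (intro exI[of _ "T \<inter> S'"] exI[of _ v'] conjI ballI) auto
qed

lemma covering_space_compose_homeomorphism:
  assumes cov: "covering_space C p S" and hom: "homeomorphism B C h k"
    and f: "\<And>x. x \<in> B \<Longrightarrow> f x = p (h x)"
  shows "covering_space B f S"
proof
  have hB: "h ` B = C" "continuous_on B h" using hom by (auto simp: homeomorphism_def)
  have "continuous_on B (p \<circ> h)"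
    using hB covering_space_imp_continuous[OF cov] by (intro continuous_on_compose) auto
  then show "continuous_on B f" using f by (auto cong: continuous_on_cong)
  have "f ` B = p ` h ` B" using f by (force simp: image_image)
  then show "f ` B = S" using hB covering_space_imp_surjective[OF cov] by simp
  fix x assume x: "x \<in> S"
  then obtain T v where T: "x \<in> T" "openin (top_of_set S) T"
    and v: "\<Union>v = C \<inter> p -` T" "\<And>u. u \<in> v \<Longrightarrow> openin (top_of_set C) u" "pairwise disjnt v"
      "\<And>u. u \<in> v \<Longrightarrow> \<exists>q. homeomorphism u T p q"
    using covering_space_evenly_covered[OF cov] by blast
  define v' where "v' = (\<lambda>u. B \<inter> h -` u) ` v"
  have "\<Union>v' = B \<inter> h -` (\<Union>v)" by (auto simp: v'_def)
  then have "\<Union>v' = B \<inter> f -` T"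
    unfolding v(1) using hB(1) f by auto
  moreover have "openin (top_of_set B) w" if "w \<in> v'" for w
    using that v(2) hB continuous_openin_preimage[of B h C] by (auto simp: v'_def)
  moreover have "pairwise disjnt v'"
    using v(3) unfolding v'_def pairwise_def disjnt_def by blast
  moreover have "\<exists>q. homeomorphism w T f q" if w: "w \<in> v'" for w
  proof -
    obtain u where u: "u \<in> v" "w = B \<inter> h -` u" using w by (auto simp: v'_def)
    obtain q where q: "homeomorphism u T p q" using v(4)[OF u(1)] by blast
    have uC: "u \<subseteq> C" using u(1) v(1) by auto
    have "homeomorphism w u h k"
    proof (rule homeomorphism_of_subsets[OF hom])
      show "h ` w = u" using u(2) uC hB(1) by auto
    qed (use u uC in auto)
    then have "homeomorphism w T (p \<circ> h) (k \<circ> q)" using q by (rule homeomorphism_compose)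
    then have "homeomorphism w T f (k \<circ> q)"
      by (rule homeomorphism_cong) (use f u(2) in auto)
    then show ?thesis by blast
  qed
  ultimately show "\<exists>T. x \<in> T \<and> openin (top_of_set S) T \<and>
      (\<exists>v. \<Union>v = B \<inter> f -` T \<and> (\<forall>u\<in>v. openin (top_of_set B) u) \<and>
        pairwise disjnt v \<and> (\<forall>u\<in>v. \<exists>q. homeomorphism u T f q))"
    using x T by (intro exI[of _ T] exI[of _ v'] conjI ballI) auto
qed

section \<open>Direct tracts bounded by a simple curve\<close>

theorem theorem1p1:
  fixes f :: "complex \<Rightarrow> complex" and D :: "complex set" and R :: real
  assumes "direct_tract f D R"
    and "unbounded_simple_curve (frontier D)"
  shows "logarithmic_tract f D R"
proof -
  have D: "open D" "connected D" "\<not> bounded D"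
    and f: "f holomorphic_on D" "continuous_on (closure D) f" "R > 0"
      "\<And>z. z \<in> frontier D \<Longrightarrow> norm (f z) = R" "\<And>z. z \<in> D \<Longrightarrow> norm (f z) > R"
    using assms(1) by (auto simp: direct_tract_def)
  obtain \<gamma> :: "real \<Rightarrow> complex" where \<gamma>: "continuous_on UNIV \<gamma>" "filterlim \<gamma> at_infinity at_top"
    "frontier D = range \<gamma>"
    using assms(2) by (auto simp: unbounded_simple_curve_def)
  have conn: "connected (frontier D)"
    unfolding \<gamma>(3) using \<gamma>(1) by (intro connected_continuous_image) auto
  have "\<not> bounded (frontier D)"
  proof
    assume "bounded (frontier D)"
    then obtain B where "\<And>t. norm (\<gamma> t) \<le> B" unfolding \<gamma>(3) bounded_iff by auto
    moreover have "eventually (\<lambda>t. B + 1 \<le> norm (\<gamma> t)) at_top"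
      using filterlim_at_infinity_imp_norm_at_top[OF \<gamma>(2)] unfolding filterlim_at_top by blast
    then obtain t where "B + 1 \<le> norm (\<gamma> t)" by (auto simp: eventually_at_top_linorder)
    ultimately show False by (meson add_le_same_cancel1 not_one_le_zero order.trans)
  qed
  then have sc: "simply_connected D"
    using D conn connected_eq_components_subset_sing[of "frontier D"]
    by (auto simp: simply_connected_eq_frontier_properties)
  have fnz: "f z \<noteq> 0" if "z \<in> D" for z using f(3) f(5)[OF that] by auto
  then have "(\<lambda>z. f z / R) holomorphic_on D" "\<forall>z\<in>D. f z / R \<noteq> 0"
    using f(1,3) by (auto intro!: holomorphic_intros)
  then obtain g where g: "g holomorphic_on D" "\<And>z. z \<in> D \<Longrightarrow> f z / R = exp (g z)"
    using sc simply_connected_eq_holomorphic_log[OF D(1)] by blast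
  have fg: "f z = exp (g z + ln R)" if "z \<in> D" for z
    using g(2)[OF that] f(3) by (simp add: exp_add exp_of_real field_simps)
  have Re_g: "Re (g z) = ln (norm (f z)) - ln R" if "z \<in> D" for z
    using fg[OF that] by (simp add: norm_exp_eq_Re)
  interpret half_plane_map D g
  proof
    show "D \<noteq> {}" using D(3) by auto
    show "D \<noteq> UNIV" using \<gamma>(3) by auto
    show "0 < Re (g z)" if "z \<in> D" for z
    proof -
      have "ln R < ln (norm (f z))" using f(3) f(5)[OF that] by (subst ln_less_cancel_iff) auto
      then show ?thesis using Re_g[OF that] by simp
    qed
    show "((\<lambda>z. Re (g z)) \<longlongrightarrow> 0) (at \<zeta> within D)" if \<zeta>: "\<zeta> \<in> frontier D" for \<zeta>
    proof -
      have "(f \<longlongrightarrow> f \<zeta>) (at \<zeta> within closure D)"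
        using f(2) \<zeta> by (auto simp: continuous_on_def frontier_def)
      then have "(f \<longlongrightarrow> f \<zeta>) (at \<zeta> within D)"
        by (rule tendsto_within_subset) (rule closure_subset)
      then have "((\<lambda>z. ln (norm (f z)) - ln R) \<longlongrightarrow> ln (norm (f \<zeta>)) - ln R) (at \<zeta> within D)"
        using f(3) f(4)[OF \<zeta>] by (intro tendsto_intros) auto
      then have "((\<lambda>z. ln (norm (f z)) - ln R) \<longlongrightarrow> 0) (at \<zeta> within D)"
        using f(4)[OF \<zeta>] by simp
      then show ?thesis
        by (rule Lim_transform_eventually)
          (use eventually_at_within_in[of D \<zeta>] in \<open>auto elim: eventually_mono simp: Re_g\<close>)
    qed
  qed (use D sc conn g(1) in auto)
  define S where "S = {z::complex. norm z > R}"
  \<comment> \<open>The shift by \<open>ln R\<close> turns \<open>f = R exp g\<close> into \<open>f = exp \<circ> G\<close>, a restriction of the exponential covering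
    of the punctured plane.\<close>
  define G where "G = (\<lambda>z. g z + of_real (ln R))"
  have "inj_on G D" using inj_on_g by (auto simp: G_def inj_on_def)
  have holG: "G holomorphic_on D" unfolding G_def using g(1) by (intro holomorphic_intros)
  have "G ` D = UNIV \<inter> exp -` S"
  proof -
    have "G ` D = (\<lambda>w. w + of_real (ln R)) ` (g ` D)" by (auto simp: G_def image_image)
    also have "\<dots> = {w. ln R < Re w}"
      unfolding image_g by (auto simp: image_iff intro!: exI[of _ "_ - of_real (ln R)"])
    also have "\<dots> = UNIV \<inter> exp -` S"
    proof -
      have "ln R < x \<longleftrightarrow> R < exp x" for x :: real
        using f(3) by (metis exp_less_cancel_iff exp_ln)
      then show ?thesis by (auto simp: S_def)
    qed
    finally show ?thesis .
  qed
  moreover obtain k where "homeomorphism D (G ` D) G k"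
    using invariance_of_domain_homeomorphism[OF D(1) holomorphic_on_imp_continuous_on[OF holG] _ \<open>inj_on G D\<close>]
    by auto
  ultimately have hom: "homeomorphism D (UNIV \<inter> exp -` S) G k" by simp
  have "covering_space (UNIV \<inter> exp -` S) exp S"
    using f(3) by (intro covering_space_restrict[OF covering_space_exp_punctured_plane]) (auto simp: S_def)
  then have "covering_space D f S"
    using hom by (rule covering_space_compose_homeomorphism) (simp add: fg G_def)
  then show ?thesis
    using assms(1) sc by (simp add: logarithmic_tract_def universal_covering_def S_def)
qed

end
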